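(* Let $k\ge 1$, let $n_1,\dots,n_k$ be positive integers and $L_1,\dots,L_k$ positive reals, let $\mathbf N=\big((n_1,L_1),\dots,(n_k,L_k)\big)$ and $n=n_1+\dots+n_k$. A polygon $P\in\mathcal M_{sm}(\mathbf N)$ is a critical point of the oriented area function $\mathcal A\colon\mathcal M_{sm}(\mathbf N)\to\mathbb R$ if and only if all of the following conditions hold: (1) $P$ is cyclic (i.e. its vertices lie on a circle); (2) for every $j\in\{1,\dots,k\}$ and every $i\in j^*$, $l_i(P)=L_j/n_j$; (3) for every $j\in\{1,\dots,k\}$ and all $i_1,i_2\in j^*$, $\varepsilon_{i_1}(P)=\varepsilon_{i_2}(P)$. (If the circle containing the vertices of $P$ is not unique, conditions (1) and (3) are understood as: there is a circle containing all vertices of $P$ such that (3) holds for the orientations $\varepsilon_i$ computed with respect to its centre.)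
   Context: A planar $n$-gon is a tuple $P=(p_1,\dots,p_n)\in\mathrm{Poly}_n=(\mathbb R^2)^n$; vertex indices are cyclic modulo $n$; $l_i(P)=|p_{i+1}-p_i|$. A necklace is a tuple $\mathbf N=\big((n_1,L_1),\dots,(n_k,L_k)\big)$ with $n_j$ positive integers and $L_j$ positive reals; $n=n_1+\dots+n_k$. Put $j^*=\{n_1+\dots+n_{j-1}+1,\dots,n_1+\dots+n_j\}$ and $\mathcal L_j(P)=\sum_{i\in j^*}l_i(P)$. A configuration of $\mathbf N$ is $P\in\mathrm{Poly}_n$ with $\mathcal L_j(P)=L_j$ for all $j=1,\dots,k$. It is non-singular if $\mathcal L=(\mathcal L_1,\dots,\mathcal L_k)$ is differentiable at $P$ with surjective differential $\mathbb R^{2n}\to\mathbb R^k$. $\widetilde{\mathcal M_{sm}}(\mathbf N)\subset\mathrm{Poly}_n$ is the set of non-singular configurations (a smooth submanifold), and $\mathcal M_{sm}(\mathbf N)=\widetilde{\mathcal M_{sm}}(\mathbf N)/\mathrm{Isom}_+(\mathbb R^2)$, the quotient by the diagonal action (free and proper) of the group of orientation-preserving isometries of the plane, with the smooth structure for which the quotient map is a smooth submersion. Oriented area: for $P=((x_1,y_1),\dots,(x_n,y_n))$, $\mathcal A(P)=\frac12\sum_{i=1}^n(x_iy_{i+1}-x_{i+1}y_i)$; it is $\mathrm{Isom}_+(\mathbb R^2)$-invariant and so defines a smooth function on $\mathcal M_{sm}(\mathbf N)$. A critical point is a point where $d\mathcal A=0$. For a polygon $P$ inscribed in a circle with centre $o$,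 with oriented angles $\angle p_iop_{i+1}$ taken in $(-\pi,\pi]$, the orientation of the $i$-th side is $\varepsilon_i(P)=1$ if $\angle p_iop_{i+1}\in(0,\pi)$, $0$ if $\angle p_iop_{i+1}\in\{0,\pi\}$, and $-1$ if $\angle p_iop_{i+1}\in(-\pi,0)$. *)

theory Defs
  imports "HOL-Analysis.Analysis" "Berlekamp_Zassenhaus.Finite_Field"
begin

section \<open>Smooth maps, tangent vectors and smooth manifolds\<close>

text \<open>\<open>C\<^sup>k\<close> on an open set \<open>S\<close>, through iterated directional derivatives.\<close>

primrec C_k_on :: "nat \<Rightarrow> 'a::real_normed_vector set \<Rightarrow> ('a \<Rightarrow> 'b::real_normed_vector) \<Rightarrow> bool" where
  "C_k_on 0 S f \<longleftrightarrow> continuous_on S f"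
| "C_k_on (Suc k) S f \<longleftrightarrow>
     (\<forall>x\<in>S. f differentiable (at x)) \<and> (\<forall>v. C_k_on k S (\<lambda>x. frechet_derivative f (at x) v))"

text \<open>For an arbitrary subset \<open>S\<close> of a Euclidean space (used for embedded submanifolds),
  smooth means: locally the restriction of a \<open>C\<^sup>\<infinity>\<close> map defined on an open set.\<close>

definition smooth_on :: "'a::euclidean_space set \<Rightarrow> ('a \<Rightarrow> 'b::euclidean_space) \<Rightarrow> bool" where
  "smooth_on S f \<longleftrightarrow>
     (\<forall>x\<in>S. \<exists>W F. open W \<and> x \<in> W \<and> (\<forall>k. C_k_on k W F) \<and> (\<forall>y\<in>W \<inter> S. F y = f y))"

text \<open>The velocities at \<open>x\<close> of curves in \<open>S\<close> through \<open>x\<close>.\<close>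

definition tangent_space :: "'a::euclidean_space set \<Rightarrow> 'a \<Rightarrow> 'a set" where
  "tangent_space S x =
     {v. \<exists>c. c 0 = x \<and> (\<forall>\<^sub>F t in nhds 0. c t \<in> S) \<and> (c has_vector_derivative v) (at (0::real))}"

text \<open>A smooth atlas on the topological space \<open>X\<close>, making \<open>X\<close> a smooth manifold. The model space
  is a linear subspace \<open>E\<close> of a Euclidean space rather than a type such as \<open>real^'d\<close>, because
  dimension 0 must be allowed (e.g. moduli of triangles). The charts are pairs of a domain and
  a map; the values of the map outside the domain are irrelevant.\<close>

definition smooth_atlas ::
    "'m topology \<Rightarrow> 'e::euclidean_space set \<Rightarrow> ('m set \<times> ('m \<Rightarrow> 'e)) set \<Rightarrow> bool" where
  "smooth_atlas X E \<A> \<longleftrightarrow>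
     Hausdorff_space X \<and> second_countable X \<and> subspace E \<and>
     (\<Union>(U, \<phi>)\<in>\<A>. U) = topspace X \<and>
     (\<forall>(U, \<phi>)\<in>\<A>. openin X U \<and> openin (top_of_set E) (\<phi> ` U) \<and>
        homeomorphic_map (subtopology X U) (top_of_set (\<phi> ` U)) \<phi>) \<and>
     (\<forall>(U, \<phi>)\<in>\<A>. \<forall>(V, \<psi>)\<in>\<A>. smooth_on (\<phi> ` (U \<inter> V)) (\<psi> \<circ> inv_into U \<phi>))"

text \<open>\<open>q\<close> is a smooth submersion from an embedded submanifold \<open>S\<close> of a Euclidean space to the
  manifold with atlas \<open>\<A>\<close>: in every chart it is smooth, with differential mapping the tangent
  space onto \<open>E\<close>. (The derivative \<open>D\<close> within \<open>W\<close> is only determined on tangent vectors.)\<close>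

definition smooth_submersion ::
    "'a::euclidean_space set \<Rightarrow> ('a \<Rightarrow> 'm) \<Rightarrow> 'e::euclidean_space set \<Rightarrow> ('m set \<times> ('m \<Rightarrow> 'e)) set \<Rightarrow> bool"
  where
  "smooth_submersion S q E \<A> \<longleftrightarrow>
     (\<forall>(U, \<phi>)\<in>\<A>. let W = {P \<in> S. q P \<in> U} in
        smooth_on W (\<phi> \<circ> q) \<and>
        (\<forall>P\<in>W. \<exists>D. ((\<phi> \<circ> q) has_derivative D) (at P within W) \<and> D ` tangent_space W P = E))"

text \<open>The differential of \<open>f\<close> vanishes at \<open>x\<close>, computed in a chart around \<open>x\<close>; for a smooth atlas
  the choice of the chart is immaterial.\<close>

definition critical_point :: "('m set \<times> ('m \<Rightarrow> 'e::euclidean_space)) set \<Rightarrow> ('m \<Rightarrow> real) \<Rightarrow> 'm \<Rightarrow> bool"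
  where
  "critical_point \<A> f x \<longleftrightarrow>
     (\<exists>(U, \<phi>)\<in>\<A>. x \<in> U \<and>
        ((f \<circ> inv_into U \<phi>) has_derivative (\<lambda>_. 0)) (at (\<phi> x) within \<phi> ` U))"


section \<open>Polygons and necklaces\<close>

text \<open>The plane is \<open>complex\<close>; the vertices of an \<open>n\<close>-gon are indexed by the type \<open>'n mod_ring\<close> of
  integers modulo \<open>n = CARD('n)\<close>, addressed by natural numbers (starting from 0) read modulo \<open>n\<close>.\<close>

type_synonym 'n polygon = "complex ^ 'n mod_ring"

definition vertex :: "'n::finite polygon \<Rightarrow> nat \<Rightarrow> complex" where
  "vertex P i = P $ of_int_mod_ring (int i)"

definition side_length :: "'n::finite polygon \<Rightarrow> nat \<Rightarrow> real" where
  "side_length P i = cmod (vertex P (i + 1) - vertex P i)"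

definition oriented_area :: "'n::finite polygon \<Rightarrow> real" where
  "oriented_area P = 1 / 2 * (\<Sum>i<CARD('n).
     Re (vertex P i) * Im (vertex P (i + 1)) - Re (vertex P (i + 1)) * Im (vertex P i))"

text \<open>\<open>Arg\<close> takes values in \<open>(-\<pi>, \<pi>]\<close>, so this is the oriented angle \<open>p\<^sub>i o p\<^sub>i\<^sub>+\<^sub>1\<close> when both
  vertices are different from \<open>o\<close>.\<close>

definition central_angle :: "complex \<Rightarrow> 'n::finite polygon \<Rightarrow> nat \<Rightarrow> real" where
  "central_angle o' P i = Arg ((vertex P (i + 1) - o') / (vertex P i - o'))"

definition side_orientation :: "complex \<Rightarrow> 'n::finite polygon \<Rightarrow> nat \<Rightarrow> int" where
  "side_orientation o' P i =
     (if central_angle o' P i \<in> {0<..<pi} then 1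
      else if central_angle o' P i \<in> {0, pi} then 0
      else - 1)"

text \<open>The necklace \<open>((n\<^sub>1, L\<^sub>1), \<dots>, (n\<^sub>k, L\<^sub>k))\<close> as a list; beads and vertices are numbered from 0.\<close>

type_synonym necklace = "(nat \<times> real) list"

definition is_necklace :: "necklace \<Rightarrow> bool" where
  "is_necklace N \<longleftrightarrow> N \<noteq> [] \<and> (\<forall>(m, L)\<in>set N. m > 0 \<and> L > 0)"

definition total_number :: "necklace \<Rightarrow> nat" where
  "total_number N = sum_list (map fst N)"

definition block :: "necklace \<Rightarrow> nat \<Rightarrow> nat set" where
  "block N j = {total_number (take j N) ..< total_number (take (Suc j) N)}"

definition block_length :: "necklace \<Rightarrow> nat \<Rightarrow> 'n::finite polygon \<Rightarrow> real" where
  "block_length N j P = (\<Sum>i\<in>block N j. side_length P i)"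

definition configurations :: "necklace \<Rightarrow> 'n::finite polygon set" where
  "configurations N = {P. \<forall>j<length N. block_length N j P = snd (N ! j)}"

text \<open>The map \<open>(\<L>\<^sub>1, \<dots>, \<L>\<^sub>k)\<close> is differentiable at \<open>P\<close> with surjective differential
  \<open>v \<mapsto> (D 0 v, \<dots>, D (k - 1) v)\<close>; here \<open>\<real>\<^sup>k\<close> is written out in components since \<open>k\<close> is
  the length of a list.\<close>

definition nonsingular :: "necklace \<Rightarrow> 'n::finite polygon \<Rightarrow> bool" where
  "nonsingular N P \<longleftrightarrow>
     (\<exists>D. (\<forall>j<length N. (block_length N j has_derivative D j) (at P)) \<and>
          (\<forall>y :: nat \<Rightarrow> real. \<exists>v. \<forall>j<length N. D j v = y j))"

definition nonsingular_configurations :: "necklace \<Rightarrow> 'n::finite polygon set" where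
  "nonsingular_configurations N = {P \<in> configurations N. nonsingular N P}"


section \<open>The moduli space\<close>

text \<open>An isometry \<open>g\<close> of the plane is affine, and the last condition says that the determinant of
  its linear part, with columns \<open>g 1 - g 0\<close> and \<open>g \<i> - g 0\<close>, is positive.\<close>

definition Isom_plus :: "(complex \<Rightarrow> complex) set" where
  "Isom_plus = {g. (\<forall>z w. dist (g z) (g w) = dist z w) \<and> Im (cnj (g 1 - g 0) * (g \<i> - g 0)) > 0}"

definition orbit :: "'n::finite polygon \<Rightarrow> 'n polygon set" where
  "orbit P = {(\<chi> i. g (P $ i)) | g. g \<in> Isom_plus}"

definition moduli_space :: "necklace \<Rightarrow> 'n::finite polygon set set" where
  "moduli_space N = orbit ` nonsingular_configurations N"

text \<open>\<open>X\<close> and \<open>\<A>\<close> are the quotient topology and (an atlas of) the smooth structure on the moduli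
  space for which the quotient map is a smooth submersion. Both are determined by this property,
  the second one up to equivalence of atlases; it also determines the dimension of \<open>E\<close>.\<close>

definition moduli_smooth_structure ::
    "necklace \<Rightarrow> 'n::finite polygon set topology \<Rightarrow> 'e::euclidean_space set \<Rightarrow>
     ('n polygon set set \<times> ('n polygon set \<Rightarrow> 'e)) set \<Rightarrow> bool" where
  "moduli_smooth_structure N X E \<A> \<longleftrightarrow>
     topspace X = moduli_space N \<and>
     quotient_map (top_of_set (nonsingular_configurations N)) X orbit \<and>
     smooth_atlas X E \<A> \<and>
     smooth_submersion (nonsingular_configurations N) orbit E \<A>"

text \<open>The area is constant on orbits; this is its common value.\<close>

definition moduli_area :: "'n::finite polygon set \<Rightarrow> real" where
  "moduli_area x = the_elem (oriented_area ` x)"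

end

(* At a non-singular configuration no side vanishes, so the constraints are smooth with independent
   differentials nearby, and P is critical iff dA = sum of lambda_j dL_j for some multipliers.
   On the side p q of bead j, with unit direction u, put the point c = (p + q)/2 + i lambda_j u of the
   perpendicular bisector. The Lagrange equation at a vertex says precisely that the points c of
   the two adjacent sides coincide, so the multipliers exist iff all these points are one centre.
   The signed distance lambda_j of the centre from a side and the radius determine both the length
   and the orientation of the side, and conversely. *)
theory Submission
  imports Defs
begin

section \<open>Regular constraints and critical points on quotients\<close>

text \<open>The smooth structure on the moduli space is an arbitrary atlas, known only through the
  fact that \<open>orbit\<close> is a submersion, so criticality in a chart has to be compared with
  derivatives on the space of polygons. One direction pulls the chart function back along the
  quotient map. The other needs lifts: every chart value near that of \<open>P\<close> must come
  from a configuration whose distance to \<open>P\<close> is bounded linearly by the chart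
  displacement. Then \<open>oriented_area\<close> minus the multiplier combination of the bead
  lengths, which has zero derivative at \<open>P\<close>, gives the required estimate in the chart.
  The lifts, and the curves that realise tangent vectors, are solutions of equations
  \<open>G Q = y\<close> where \<open>G\<close> has the identity as derivative at \<open>P\<close>.
  A second point is that surjectivity of the differential survives small perturbations, so that near
  \<open>P\<close> the non-singular configurations are exactly the polygons with the same bead
  lengths as \<open>P\<close>.\<close>

text \<open>A solution of \<open>f Q = y\<close> is a fixed point of
  \<open>Q \<mapsto> y + (Q - f Q)\<close>. Brouwer's theorem supplies one from continuity and the
  derivative at the single point \<open>P\<close>; the price is that \<open>Q\<close> need not
  depend continuously on \<open>y\<close>.\<close>

lemma local_surjectivity:
  fixes f :: "'a::euclidean_space \<Rightarrow> 'a"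
  assumes "open S" "P \<in> S" "continuous_on S f" "(f has_derivative (\<lambda>h. h)) (at P)"
  obtains \<delta> where "\<delta> > 0"
    "\<And>y. norm (y - f P) < \<delta> \<Longrightarrow> \<exists>Q\<in>S. norm (Q - P) \<le> 2 * norm (y - f P) \<and> f Q = y"
proof -
  obtain d where d: "d > 0"
    "\<And>Q. norm (Q - P) < d \<Longrightarrow> norm (f Q - f P - (Q - P)) \<le> 1/2 * norm (Q - P)"
    using assms(4) unfolding has_derivative_at_alt by (meson half_gt_zero zero_less_one)
  obtain r where r: "r > 0" "ball P r \<subseteq> S"
    using assms(1,2) openE by blast
  show ?thesis
  proof (rule that[of "min d r / 2"])
    show "min d r / 2 > 0" using d r by simp
    fix y assume y: "norm (y - f P) < min d r / 2"
    \<comment> \<open>The radius is chosen so that the fixed point map preserves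
      \<open>cball P e\<close>: the shift \<open>y - f P\<close> uses up \<open>e / 2\<close>, and
      the remainder of \<open>f\<close> at \<open>P\<close>, at most half of
      \<open>norm (Q - P)\<close>, the other \<open>e / 2\<close>.\<close>
    define e where "e = 2 * norm (y - f P)"
    show "\<exists>Q\<in>S. norm (Q - P) \<le> 2 * norm (y - f P) \<and> f Q = y"
    proof (cases "y = f P")
      case True
      then show ?thesis using assms(2) by auto
    next
      case False
      then have e: "e > 0" "e < d" "e < r" using y by (auto simp: e_def)
      have sub: "cball P e \<subseteq> S" using e(3) r(2) by force
      have "\<exists>Q\<in>cball P e. f Q = y"
      proof (rule brouwer_surjective_cball[where S = "{y}"])
        show "continuous_on (cball P e) f"
          using assms(3) sub continuous_on_subset by blast
        fix x Q assume x: "x \<in> {y}" and Q: "Q \<in> cball P e"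
        have Q': "norm (Q - P) \<le> e" using Q by (simp add: dist_norm norm_minus_commute)
        have "norm (y + (Q - f Q) - P) = norm ((y - f P) - (f Q - f P - (Q - P)))"
          by (simp add: algebra_simps)
        also have "\<dots> \<le> norm (y - f P) + norm (f Q - f P - (Q - P))"
          by (rule norm_triangle_ineq4)
        also have "\<dots> \<le> e" using d(2)[of Q] Q' e by (simp add: e_def)
        finally show "x + (Q - f Q) \<in> cball P e"
          using x by (simp add: dist_norm norm_minus_commute)
      qed (use e in auto)
      then obtain Q where "Q \<in> cball P e" "f Q = y" by blast
      then show ?thesis
        using sub by (intro bexI[of _ Q]) (auto simp: e_def dist_norm norm_minus_commute)
    qed
  qed
qed

text \<open>Surjectivity of the joint differential is recorded by the family \<open>w\<close> dual
  to \<open>D\<close>, which is an explicit right inverse and can be used in formulas.\<close>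

locale regular_constraints =
  fixes J :: "'j set" and L :: "'j \<Rightarrow> 'a::euclidean_space \<Rightarrow> real"
    and D :: "'j \<Rightarrow> 'a \<Rightarrow> real" and w :: "'j \<Rightarrow> 'a" and P :: 'a
  assumes finite_J: "finite J"
    and continuous: "j \<in> J \<Longrightarrow> continuous_on UNIV (L j)"
    and derivative: "j \<in> J \<Longrightarrow> (L j has_derivative D j) (at P)"
    and dual: "i \<in> J \<Longrightarrow> j \<in> J \<Longrightarrow> D i (w j) = (if i = j then 1 else 0)"
begin

lemma linear_D: "j \<in> J \<Longrightarrow> linear (D j)"
  using derivative has_derivative_linear by blast

text \<open>Stated for any dual family \<open>u\<close>, because \<open>local_section\<close>
  replaces \<open>w\<close> by a corrected one.\<close>

lemma D_combination:
  assumes "i \<in> J" "\<And>j. j \<in> J \<Longrightarrow> D i (u j) = (if i = j then 1 else 0)"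
  shows "D i (\<Sum>j\<in>J. a j *\<^sub>R u j) = a i"
proof -
  have "D i (\<Sum>j\<in>J. a j *\<^sub>R u j) = (\<Sum>j\<in>J. a j *\<^sub>R D i (u j))"
    by (simp add: linear_sum[OF linear_D[OF assms(1)]] linear_cmul[OF linear_D[OF assms(1)]])
  also have "\<dots> = (\<Sum>j\<in>J. if i = j then a i else 0)"
    by (rule sum.cong) (auto simp: assms(2))
  also have "\<dots> = a i" using finite_J assms(1) by simp
  finally show ?thesis .
qed

text \<open>Removing from \<open>v\<close> its components along the dual vectors \<open>w j\<close>
  leaves a vector of the common kernel, where \<open>f\<close> vanishes; the multipliers are
  therefore the values \<open>f (w j)\<close>.\<close>

lemma multipliers:
  assumes "linear f" "\<And>v. \<forall>j\<in>J. D j v = 0 \<Longrightarrow> f v = 0"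
  shows "f v = (\<Sum>j\<in>J. f (w j) * D j v)"
proof -
  have "f (v - (\<Sum>j\<in>J. D j v *\<^sub>R w j)) = 0"
    using D_combination[OF _ dual] by (intro assms(2)) (simp add: linear_diff[OF linear_D])
  then show ?thesis
    by (simp add: linear_diff[OF assms(1)] linear_sum[OF assms(1)] linear_cmul[OF assms(1)] mult.commute)
qed

text \<open>This sum turns the linearised constraints into the true ones when added to
  \<open>Q - P\<close>. Being a first-order remainder, it leaves the derivative at \<open>P\<close>
  equal to the identity.\<close>

lemma remainder_derivative:
  fixes u :: "'j \<Rightarrow> 'a"
  shows "((\<lambda>Q. \<Sum>j\<in>J. (L j Q - L j P - D j (Q - P)) *\<^sub>R u j) has_derivative (\<lambda>h. 0)) (at P)"
proof -
  have "((\<lambda>Q. (L j Q - L j P - D j (Q - P)) *\<^sub>R u j) has_derivative (\<lambda>h. 0)) (at P)" if "j \<in> J" for j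
  proof -
    have "bounded_linear (D j)" using derivative[OF that] has_derivative_bounded_linear by blast
    then have "((\<lambda>Q. D j (Q - P)) has_derivative (\<lambda>h. D j (h - 0))) (at P)"
      by (rule bounded_linear.has_derivative) (intro derivative_intros)
    then have "((\<lambda>Q. L j Q - L j P - D j (Q - P)) has_derivative (\<lambda>h. D j h - 0 - D j (h - 0))) (at P)"
      by (rule has_derivative_diff[OF has_derivative_diff[OF derivative[OF that] has_derivative_const]])
    then have "((\<lambda>Q. L j Q - L j P - D j (Q - P)) has_derivative (\<lambda>h. 0)) (at P)"
      by (rule has_derivative_eq_rhs) (simp only: diff_0_right diff_self)
    then have "((\<lambda>Q. (L j Q - L j P - D j (Q - P)) *\<^sub>R u j) has_derivative (\<lambda>h. 0 *\<^sub>R u j)) (at P)"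
      by (rule has_derivative_scaleR_left)
    then show ?thesis unfolding scaleR_zero_left .
  qed
  then have "((\<lambda>Q. \<Sum>j\<in>J. (L j Q - L j P - D j (Q - P)) *\<^sub>R u j) has_derivative (\<lambda>h. \<Sum>j\<in>J. 0)) (at P)"
    by (rule has_derivative_sum)
  then show ?thesis unfolding sum.neutral_const .
qed
lemma continuous_remainder:
  fixes u :: "'j \<Rightarrow> 'a"
  shows "continuous_on UNIV (\<lambda>Q. \<Sum>j\<in>J. (L j Q - L j P - D j (Q - P)) *\<^sub>R u j)"
proof (rule continuous_on_sum)
  fix j assume j: "j \<in> J"
  have "continuous_on UNIV (\<lambda>Q. D j (Q - P))"
    by (intro bounded_linear.continuous_on[OF has_derivative_bounded_linear[OF derivative[OF j]]]
        continuous_on_diff continuous_on_id continuous_on_const)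
  then show "continuous_on UNIV (\<lambda>Q. (L j Q - L j P - D j (Q - P)) *\<^sub>R u j)"
    by (intro continuous_intros continuous[OF j])
qed

text \<open>The map \<open>G\<close> below straightens the constraints: its derivative at \<open>P\<close> is the identity and
  \<open>D i (G Q) = L i Q - L i P\<close>, so the solutions of \<open>G Q = t v\<close> with \<open>v\<close> in the common kernel satisfy
  the constraints. Solving by Brouwer's theorem needs differentiability at \<open>P\<close> only; the curve
  need not be continuous away from 0.\<close>

lemma tangent_curve:
  assumes "\<And>j. j \<in> J \<Longrightarrow> D j v = 0"
  obtains c where "c 0 = P" "(c has_vector_derivative v) (at (0::real))"
    "\<forall>\<^sub>F t in nhds 0. \<forall>j\<in>J. L j (c t) = L j P"
proof -
  define H where "H = (\<lambda>Q. \<Sum>j\<in>J. (L j Q - L j P - D j (Q - P)) *\<^sub>R w j)"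
  define G where "G = (\<lambda>Q. (Q - P) + H Q)"
  have H: "(H has_derivative (\<lambda>h. 0)) (at P)" "continuous_on UNIV H"
    unfolding H_def by (rule remainder_derivative continuous_remainder)+
  have "(G has_derivative (\<lambda>h. (h - 0) + 0)) (at P)"
    unfolding G_def by (intro derivative_intros H)
  then have G': "(G has_derivative (\<lambda>h. h)) (at P)" by simp
  have "continuous_on UNIV G" unfolding G_def by (intro continuous_intros H)
  from local_surjectivity[OF open_UNIV UNIV_I this G'] obtain \<delta> where \<delta>: "\<delta> > 0"
    "\<And>y. norm (y - G P) < \<delta> \<Longrightarrow> \<exists>Q. norm (Q - P) \<le> 2 * norm (y - G P) \<and> G Q = y"
    by auto
  have HP: "H P = 0" by (simp add: H_def linear_0[OF linear_D])
  then have GP: "G P = 0" by (simp add: G_def)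
  have "\<exists>Q. norm (t *\<^sub>R v) < \<delta> \<longrightarrow> norm (Q - P) \<le> 2 * norm (t *\<^sub>R v) \<and> G Q = t *\<^sub>R v" for t
    using \<delta>(2)[of "t *\<^sub>R v"] by (auto simp: GP)
  then obtain c where c: "\<And>t. norm (t *\<^sub>R v) < \<delta> \<Longrightarrow> norm (c t - P) \<le> 2 * norm (t *\<^sub>R v) \<and> G (c t) = t *\<^sub>R v"
    by metis
  have c0: "c 0 = P" using c[of 0] \<delta>(1) by simp
  \<comment> \<open>The summand 1 keeps the denominator positive when \<open>v = 0\<close>.\<close>
  define \<eta> where "\<eta> = \<delta> / (norm v + 1)"
  have \<eta>: "\<eta> > 0" "norm (t *\<^sub>R v) < \<delta>" if "\<bar>t\<bar> < \<eta>" for t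
  proof -
    show "\<eta> > 0" using \<delta>(1) by (simp add: \<eta>_def add_nonneg_pos)
    have "\<bar>t\<bar> * (norm v + 1) < \<delta>"
      using that by (simp add: \<eta>_def pos_less_divide_eq add_nonneg_pos)
    then show "norm (t *\<^sub>R v) < \<delta>" by (simp add: algebra_simps)
  qed
  have \<eta>0: "\<eta> > 0" using \<delta>(1) by (simp add: \<eta>_def add_nonneg_pos)
  have "L i (c t) = L i P" if "\<bar>t\<bar> < \<eta>" "i \<in> J" for t i
  proof -
    have "D i (G (c t)) = t *\<^sub>R D i v"
      using c[OF \<eta>(2)[OF that(1)]] by (simp add: linear_cmul[OF linear_D[OF that(2)]])
    moreover have "D i (G (c t)) = D i (c t - P) + (L i (c t) - L i P - D i (c t - P))"
      unfolding G_def H_def linear_add[OF linear_D[OF that(2)]]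
      by (subst D_combination[OF that(2) dual[OF that(2)]]) auto
    ultimately show ?thesis using assms[OF that(2)] by simp
  qed
  then have ev: "\<forall>\<^sub>F t in nhds 0. \<forall>j\<in>J. L j (c t) = L j P"
    using \<eta>0 by (auto simp: eventually_nhds_metric dist_norm)
  \<comment> \<open>The error \<open>c t - P - t *\<^sub>R v\<close> equals
    \<open>- H (c t)\<close>. It is of smaller order than \<open>c t - P\<close>, whose norm is at
    most twice that of \<open>t *\<^sub>R v\<close>; hence the factor \<open>2 * norm v\<close> in
    the constants below.\<close>
  have "(c has_derivative (\<lambda>h. h *\<^sub>R v)) (at 0)"
    unfolding has_derivative_at_alt
  proof (intro conjI allI impI)
    show "bounded_linear (\<lambda>h. h *\<^sub>R v)" by (rule bounded_linear_scaleR_left)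
    fix e :: real assume "e > 0"
    define e' where "e' = e / (2 * norm v + 1)"
    have n0: "2 * norm v + 1 > 0" by (simp add: add_nonneg_pos)
    have e': "e' > 0" "e' * (2 * norm v) \<le> e"
      using \<open>e > 0\<close> n0 by (auto simp: e'_def field_simps)
    obtain d where d: "d > 0" "\<And>Q. norm (Q - P) < d \<Longrightarrow> norm (H Q) \<le> e' * norm (Q - P)"
      using H(1) e'(1) unfolding has_derivative_at_alt by (auto simp: HP)
    show "\<exists>d>0. \<forall>y. norm (y - 0) < d \<longrightarrow> norm (c y - c 0 - (y - 0) *\<^sub>R v) \<le> e * norm (y - 0)"
    proof (intro exI[of _ "min \<eta> (d / (2 * norm v + 1))"] conjI allI impI)
      show "min \<eta> (d / (2 * norm v + 1)) > 0" using \<eta>0 d(1) n0 by simp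
      fix t :: real assume t: "norm (t - 0) < min \<eta> (d / (2 * norm v + 1))"
      have ct: "norm (c t - P) \<le> 2 * norm (t *\<^sub>R v)" "G (c t) = t *\<^sub>R v"
        using c[OF \<eta>(2)[of t]] t by auto
      have "\<bar>t\<bar> * (2 * norm v + 1) < d" using t n0 by (simp add: pos_less_divide_eq)
      then have "norm (c t - P) < d" using ct(1) by (simp add: algebra_simps)
      then have "norm (H (c t)) \<le> e' * norm (c t - P)" by (rule d(2))
      also have "\<dots> \<le> e' * (2 * norm (t *\<^sub>R v))" using ct(1) e' by simp
      also have "\<dots> = \<bar>t\<bar> * (e' * (2 * norm v))" by simp
      also have "\<dots> \<le> \<bar>t\<bar> * e" using e'(2) by (intro mult_left_mono) auto
      finally have "norm (H (c t)) \<le> e * \<bar>t\<bar>" by (simp add: mult.commute)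
      moreover have "c t - c 0 - (t - 0) *\<^sub>R v = - H (c t)"
        using ct(2) by (simp add: c0 G_def algebra_simps)
      ultimately show "norm (c t - c 0 - (t - 0) *\<^sub>R v) \<le> e * norm (t - 0)" by simp
    qed
  qed
  then show ?thesis
    using that c0 ev unfolding has_vector_derivative_def by blast
qed

text \<open>Lifts values of a chart \<open>F\<close> into the level set of the constraints, with
  linear control of the distance. The map \<open>G\<close> is built so that
  \<open>G Q = K (y - F P)\<close> forces both the constraints and \<open>F Q = y\<close>.\<close>

lemma local_section:
  fixes F :: "'a \<Rightarrow> 'e::euclidean_space"
  assumes S: "open S" "P \<in> S" and F: "continuous_on S F" "(F has_derivative F') (at P)"
    and E: "subspace E" "E \<subseteq> F' ` {v. \<forall>j\<in>J. D j v = 0}"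
    and FE: "\<And>Q. Q \<in> S \<Longrightarrow> \<forall>j\<in>J. L j Q = L j P \<Longrightarrow> F Q \<in> E"
  obtains C \<delta> where "C > 0" "\<delta> > 0" "\<And>y. y \<in> E \<Longrightarrow> norm (y - F P) < \<delta> \<Longrightarrow>
    \<exists>Q\<in>S. (\<forall>j\<in>J. L j Q = L j P) \<and> F Q = y \<and> norm (Q - P) \<le> C * norm (y - F P)"
proof -
  have lF': "linear F'" using F(2) has_derivative_linear by blast
  have "subspace {v. \<forall>j\<in>J. D j v = 0}"
    unfolding subspace_def by (auto simp: linear_0[OF linear_D] linear_add[OF linear_D] linear_cmul[OF linear_D])
  from linear_exists_right_inverse_on[OF lF' this]
  obtain R where R: "range R \<subseteq> {v. \<forall>j\<in>J. D j v = 0}" "linear R" "\<forall>e\<in>F' ` {v. \<forall>j\<in>J. D j v = 0}. F' (R e) = e"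
    by blast
  \<comment> \<open>A linear projection onto \<open>E\<close>. It extends the right inverse
    \<open>R\<close> to the whole space, since for a general \<open>Q\<close> the remainder of
    \<open>F\<close> need not lie in \<open>E\<close>.\<close>
  obtain p where p: "range p \<subseteq> E" "linear p" "\<forall>e\<in>E. p e = e"
    using linear_exists_right_inverse_on[OF linear_id E(1)] by (auto simp: id_def)
  define K where "K = R \<circ> p"
  have lK: "linear K" unfolding K_def by (rule linear_compose[OF p(2) R(2)])
  have bK: "bounded_linear K" using lK linear_conv_bounded_linear by blast
  have DK: "D j (K x) = 0" if "j \<in> J" for j x
  proof -
    have "R (p x) \<in> {v. \<forall>j\<in>J. D j v = 0}" using R(1) by blast
    then show ?thesis using that by (simp add: K_def)
  qed
  have pE: "p x \<in> E" for x using p(1) by blast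
  have FK: "F' (K x) = p x" for x
    unfolding K_def o_def by (rule bspec[OF R(3)]) (rule subsetD[OF E(2) pE])
  have pp: "p (p x) = p x" for x by (rule bspec[OF p(3) pE])
  \<comment> \<open>still dual to \<open>D\<close>, and invisible to the projection of \<open>F'\<close> to \<open>E\<close>\<close>
  define u where "u = (\<lambda>j. w j - K (F' (w j)))"
  have Du: "D i (u j) = (if i = j then 1 else 0)" if "i \<in> J" "j \<in> J" for i j
    using dual[OF that] DK[OF that(1)] by (simp add: u_def linear_diff[OF linear_D[OF that(1)]])
  have Fu: "p (F' (u j)) = 0" for j
    by (simp add: u_def linear_diff[OF lF'] linear_diff[OF p(2)] FK pp)
  define H where "H = (\<lambda>Q. \<Sum>j\<in>J. (L j Q - L j P - D j (Q - P)) *\<^sub>R u j)"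
  \<comment> \<open>The two corrections do not interfere: \<open>D j\<close> annihilates the range
    of \<open>K\<close>, and \<open>p \<circ> F'\<close> annihilates every \<open>u j\<close>.
    Applying \<open>D i\<close> to \<open>G Q\<close> thus reads off the change of
    \<open>L i\<close>, and applying \<open>p \<circ> F'\<close> the change of
    \<open>F\<close>.\<close>
  define G where "G = (\<lambda>Q. (Q - P) + H Q + K (F Q - F P - F' (Q - P)))"
  have H: "(H has_derivative (\<lambda>h. 0)) (at P)" "continuous_on UNIV H"
    unfolding H_def by (rule remainder_derivative continuous_remainder)+
  have bF': "bounded_linear F'" using F(2) has_derivative_bounded_linear by blast
  have "((\<lambda>Q. F' (Q - P)) has_derivative (\<lambda>h. F' (h - 0))) (at P)"
    by (rule bounded_linear.has_derivative[OF bF']) (intro derivative_intros)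
  then have "((\<lambda>Q. F Q - F P - F' (Q - P)) has_derivative (\<lambda>h. F' h - 0 - F' (h - 0))) (at P)"
    by (rule has_derivative_diff[OF has_derivative_diff[OF F(2) has_derivative_const]])
  then have "((\<lambda>Q. K (F Q - F P - F' (Q - P))) has_derivative (\<lambda>h. K (F' h - 0 - F' (h - 0)))) (at P)"
    by (rule bounded_linear.has_derivative[OF bK])
  moreover have "((\<lambda>Q. Q - P) has_derivative (\<lambda>h. h - 0)) (at P)"
    by (rule has_derivative_diff[OF has_derivative_ident has_derivative_const])
  ultimately have "(G has_derivative (\<lambda>h. (h - 0) + 0 + K (F' h - 0 - F' (h - 0)))) (at P)"
    unfolding G_def by (intro has_derivative_add H(1))
  then have G': "(G has_derivative (\<lambda>h. h)) (at P)"
    by (rule has_derivative_eq_rhs) (simp only: diff_0_right add_0_right diff_self linear_0[OF lK])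
  have "continuous_on S (\<lambda>Q. F' (Q - P))"
    by (rule bounded_linear.continuous_on[OF bF']) (intro continuous_on_diff continuous_on_id continuous_on_const)
  then have "continuous_on S (\<lambda>Q. F Q - F P - F' (Q - P))"
    by (rule continuous_on_diff[OF continuous_on_diff[OF F(1) continuous_on_const]])
  then have "continuous_on S (\<lambda>Q. K (F Q - F P - F' (Q - P)))"
    by (rule bounded_linear.continuous_on[OF bK])
  moreover have "continuous_on S (\<lambda>Q. Q - P + H Q)"
    by (rule continuous_on_add[OF continuous_on_diff[OF continuous_on_id continuous_on_const]
          continuous_on_subset[OF H(2) subset_UNIV]])
  ultimately have "continuous_on S G"
    unfolding G_def by (rule continuous_on_add[rotated])
  from local_surjectivity[OF S this G'] obtain \<delta> where \<delta>: "\<delta> > 0"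
    "\<And>y. norm (y - G P) < \<delta> \<Longrightarrow> \<exists>Q\<in>S. norm (Q - P) \<le> 2 * norm (y - G P) \<and> G Q = y"
    by auto
  have GP: "G P = 0"
    by (simp add: G_def H_def linear_0[OF linear_D] linear_0[OF lK] linear_0[OF lF'])
  obtain B where B: "B > 0" "\<And>x. norm (K x) \<le> norm x * B"
    using bounded_linear.pos_bounded[OF bK] by auto
  show ?thesis
  proof (rule that[of "2 * B" "\<delta> / B"])
    show "2 * B > 0" "\<delta> / B > 0" using B \<delta> by auto
    fix y assume y: "y \<in> E" "norm (y - F P) < \<delta> / B"
    have "norm (K (y - F P)) < \<delta>"
      using B(2)[of "y - F P"] y(2) B(1) by (simp add: pos_less_divide_eq)
    then obtain Q where Q: "Q \<in> S" "norm (Q - P) \<le> 2 * norm (K (y - F P))" "G Q = K (y - F P)"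
      using \<delta>(2)[of "K (y - F P)"] by (auto simp: GP)
    have LQ: "L i Q = L i P" if "i \<in> J" for i
    proof -
      have "D i (G Q) = D i (Q - P) + (L i Q - L i P - D i (Q - P)) + 0"
        unfolding G_def H_def linear_add[OF linear_D[OF that]] DK[OF that]
        by (subst D_combination[OF that Du[OF that]]) auto
      then show ?thesis using Q(3) DK[OF that] by simp
    qed
    \<comment> \<open>The constraints are already solved, so \<open>F Q\<close> lies in
      \<open>E\<close> and the projection \<open>p\<close> loses nothing of
      \<open>F Q - F P\<close>.\<close>
    have FQE: "F Q \<in> E" "F P \<in> E" using FE S(2) Q(1) LQ by auto
    have pH: "p (F' (H Q)) = 0"
      by (simp add: H_def linear_sum[OF lF'] linear_sum[OF p(2)] linear_cmul[OF lF'] linear_cmul[OF p(2)] Fu)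
    have dE: "y - F P \<in> E" "F Q - F P \<in> E"
      using y(1) FQE by (auto intro: subspace_diff[OF E(1)])
    have "p (F' (G Q)) = p (F' (Q - P)) + 0 + (p (F Q - F P) - p (F' (Q - P)))"
      by (simp add: G_def linear_add[OF lF'] linear_add[OF p(2)] linear_diff[OF p(2)] linear_diff[OF lF'] pH FK pp)
    also have "\<dots> = F Q - F P" using dE p(3) by simp
    finally have "F Q - F P = p (y - F P)" unfolding Q(3) FK pp by simp
    then have "F Q = y" using dE p(3) by simp
    moreover have "norm (Q - P) \<le> 2 * B * norm (y - F P)"
      using Q(2) B(2)[of "y - F P"] by (simp add: mult.commute)
    ultimately show "\<exists>Q\<in>S. (\<forall>j\<in>J. L j Q = L j P) \<and> F Q = y \<and> norm (Q - P) \<le> 2 * B * norm (y - F P)"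
      using Q(1) LQ by blast
  qed
qed

end

section \<open>Critical points in a chart and Lagrange multipliers\<close>

text \<open>A derivative within a thin set is not unique as a linear map, but along a curve in
  \<open>W\<close> the chain rule determines it in the direction of the velocity.\<close>

lemma tangent_derivative_unique:
  fixes f :: "'a::euclidean_space \<Rightarrow> 'b::real_normed_vector"
  assumes f: "(f has_derivative f1) (at P within W)" "(f has_derivative f2) (at P within W)"
    and v: "v \<in> tangent_space W P" and P: "P \<in> W"
  shows "f1 v = f2 v"
proof -
  obtain c where c: "c 0 = P" "\<forall>\<^sub>F t in nhds 0. c t \<in> W" "(c has_vector_derivative v) (at (0::real))"
    using v unfolding tangent_space_def by blast
  \<comment> \<open>The curve is known to stay in \<open>W\<close> only near 0. Resetting it to
    \<open>P\<close> elsewhere puts its whole range into \<open>W\<close> without changing the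
    derivative at 0.\<close>
  define c' where "c' = (\<lambda>t. if c t \<in> W then c t else P)"
  have "\<forall>\<^sub>F t in nhds 0. c t = c' t"
    using c(2) by eventually_elim (simp add: c'_def)
  then have ev: "\<forall>\<^sub>F t in at 0. c t = c' t" and c0: "c 0 = c' 0"
    by (auto simp: eventually_at_filter elim: eventually_mono dest: eventually_nhds_x_imp_x)
  have "(c has_derivative (\<lambda>h. h *\<^sub>R v)) (at 0)"
    using c(3) by (simp add: has_vector_derivative_def)
  then have d: "(c' has_derivative (\<lambda>h. h *\<^sub>R v)) (at 0)"
    by (rule has_derivative_transform_eventually[OF _ ev c0 UNIV_I])
  have W: "range c' \<subseteq> W" using P by (auto simp: c'_def)
  have P0: "c' 0 = P" using c(1) c0 by simp
  have "((\<lambda>t. f (c' t)) has_derivative (\<lambda>h. g (h *\<^sub>R v))) (at 0)"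
    if "(f has_derivative g) (at P within W)" for g
    by (rule has_derivative_in_compose[OF d]) (use has_derivative_subset[OF that W] P0 in simp)
  from has_derivative_unique[OF this[OF f(1)] this[OF f(2)]]
  have "(\<lambda>h. f1 (h *\<^sub>R v)) = (\<lambda>h. f2 (h *\<^sub>R v))" .
  from fun_cong[OF this, of 1] show ?thesis by simp
qed

context regular_constraints
begin

text \<open>Near \<open>P\<close> the set \<open>S\<close> is a level set, so its tangent space is
  the common kernel of the \<open>D j\<close>. If the chart function is critical, its pullback shows
  that \<open>F'\<close> vanishes on this kernel, and \<open>multipliers\<close> applies.
  Conversely, \<open>F\<close> and \<open>F\<close> minus the multiplier combination have the same
  increments on the level set, and the latter has zero derivative at \<open>P\<close>;
  \<open>local_section\<close> carries the estimate to the chart.\<close>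

lemma critical_point_iff_multipliers:
  fixes q :: "'a \<Rightarrow> 'm" and E :: "'e::euclidean_space set" and f :: "'m \<Rightarrow> real"
  assumes P: "P \<in> S"
    and S: "\<epsilon> > 0" "\<And>Q. norm (Q - P) < \<epsilon> \<Longrightarrow> Q \<in> S \<longleftrightarrow> (\<forall>j\<in>J. L j Q = L j P)"
    and X: "topspace X = q ` S" "quotient_map (top_of_set S) X q"
    and atlas: "smooth_atlas X E \<A>" and subm: "smooth_submersion S q E \<A>"
    and F: "\<And>Q. Q \<in> S \<Longrightarrow> f (q Q) = F Q" and F': "(F has_derivative F') (at P)"
  shows "critical_point \<A> f (q P) \<longleftrightarrow> (\<exists>\<mu>. \<forall>v. F' v = (\<Sum>j\<in>J. \<mu> j * D j v))"
proof -
  have chart: "\<exists>T. open T \<and> {Q \<in> S. q Q \<in> U} = S \<inter> T" "U \<subseteq> q ` S" "inj_on \<phi> U" "\<phi> ` U \<subseteq> E"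
    if "(U, \<phi>) \<in> \<A>" for U \<phi>
  proof -
    have U: "openin X U" "openin (top_of_set E) (\<phi> ` U)"
      "homeomorphic_map (subtopology X U) (top_of_set (\<phi> ` U)) \<phi>"
      using atlas that unfolding smooth_atlas_def by blast+
    show "U \<subseteq> q ` S" using openin_subset[OF U(1)] X(1) by simp
    then show "inj_on \<phi> U"
      using homeomorphic_imp_injective_map[OF U(3)] X(1) by (simp add: topspace_subtopology Int_absorb1)
    show "\<phi> ` U \<subseteq> E" using openin_subset[OF U(2)] by simp
    have "openin (top_of_set S) {Q \<in> topspace (top_of_set S). q Q \<in> U}"
      by (rule openin_continuous_map_preimage[OF quotient_imp_continuous_map[OF X(2)] U(1)])
    then show "\<exists>T. open T \<and> {Q \<in> S. q Q \<in> U} = S \<inter> T"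
      by (simp add: openin_open)
  qed
  have tangent: "tangent_space (S \<inter> T) P = {v. \<forall>j\<in>J. D j v = 0}" if "open T" "P \<in> T" for T
  proof (intro equalityI subsetI CollectI ballI)
    fix v j assume v: "v \<in> tangent_space (S \<inter> T) P" and j: "j \<in> J"
    \<comment> \<open>Only inside this ball is \<open>S\<close> known to be a level set; a curve
      differentiable at 0 is continuous there and so stays in the ball for small times.\<close>
    define B where "B = ball P \<epsilon>"
    have "v \<in> tangent_space (S \<inter> B) P"
    proof -
      obtain c where c: "c 0 = P" "\<forall>\<^sub>F t in nhds 0. c t \<in> S \<inter> T" "(c has_vector_derivative v) (at (0::real))"
        using v unfolding tangent_space_def by blast
      have "isCont c 0"
        using c(3) has_vector_derivative_continuous by blast
      then have "filterlim c (nhds (c 0)) (nhds 0)"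
        unfolding isCont_def by (rule tendsto_at_iff_tendsto_nhds[THEN iffD1])
      then have "filterlim c (nhds P) (nhds 0)" unfolding c(1) .
      then have "\<forall>\<^sub>F t in nhds 0. c t \<in> B"
        using S(1) by (intro topological_tendstoD) (auto simp: B_def)
      with c(2) have "\<forall>\<^sub>F t in nhds 0. c t \<in> S \<inter> B" by eventually_elim auto
      then show ?thesis using c unfolding tangent_space_def by blast
    qed
    moreover have "P \<in> S \<inter> B" using P S(1) by (simp add: B_def)
    moreover have "(L j has_derivative D j) (at P within S \<inter> B)"
      by (rule has_derivative_at_withinI[OF derivative[OF j]])
    moreover have "(L j has_derivative (\<lambda>v. 0)) (at P within S \<inter> B)"
    proof (rule has_derivative_transform[OF \<open>P \<in> S \<inter> B\<close>])
      show "((\<lambda>Q. L j P) has_derivative (\<lambda>v. 0)) (at P within S \<inter> B)" by (rule has_derivative_const)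
      show "L j Q = L j P" if "Q \<in> S \<inter> B" for Q
        using that S(2)[of Q] j by (auto simp: B_def dist_norm norm_minus_commute)
    qed
    ultimately show "D j v = 0" using tangent_derivative_unique by blast
  next
    fix v assume "v \<in> {v. \<forall>j\<in>J. D j v = 0}"
    then obtain c where c: "c 0 = P" "(c has_vector_derivative v) (at (0::real))"
      "\<forall>\<^sub>F t in nhds 0. \<forall>j\<in>J. L j (c t) = L j P"
      using tangent_curve[of v] by blast
    have "isCont c 0"
      using c(2) has_vector_derivative_continuous by blast
    then have "filterlim c (nhds (c 0)) (nhds 0)"
      unfolding isCont_def by (rule tendsto_at_iff_tendsto_nhds[THEN iffD1])
    then have "filterlim c (nhds P) (nhds 0)" unfolding c(1) .
    then have "\<forall>\<^sub>F t in nhds 0. c t \<in> T \<inter> ball P \<epsilon>"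
      using S(1) that by (intro topological_tendstoD) auto
    with c(3) have "\<forall>\<^sub>F t in nhds 0. c t \<in> S \<inter> T"
    proof eventually_elim
      case (elim t)
      then show ?case using S(2)[of "c t"] by (auto simp: dist_norm norm_minus_commute)
    qed
    then show "v \<in> tangent_space (S \<inter> T) P" using c unfolding tangent_space_def by blast
  qed
  have lF': "linear F'" using F' has_derivative_linear by blast
  show ?thesis
  proof
    assume "critical_point \<A> f (q P)"
    then obtain U \<phi> where U: "(U, \<phi>) \<in> \<A>" "q P \<in> U"
      and crit: "((f \<circ> inv_into U \<phi>) has_derivative (\<lambda>_. 0)) (at (\<phi> (q P)) within \<phi> ` U)"
      unfolding critical_point_def by blast
    obtain T where T: "open T" "{Q \<in> S. q Q \<in> U} = S \<inter> T" using chart(1)[OF U(1)] by blast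
    have PT: "P \<in> S \<inter> T" using P U(2) T(2) by blast
    obtain d where d: "((\<phi> \<circ> q) has_derivative d) (at P within S \<inter> T)"
      using subm U(1) PT unfolding smooth_submersion_def Let_def T(2)[symmetric] by blast
    have "(\<phi> \<circ> q) ` (S \<inter> T) \<subseteq> \<phi> ` U" unfolding T(2)[symmetric] by auto
    then have "((f \<circ> inv_into U \<phi>) has_derivative (\<lambda>_. 0)) (at ((\<phi> \<circ> q) P) within (\<phi> \<circ> q) ` (S \<inter> T))"
      using has_derivative_subset[OF crit] by simp
    from has_derivative_in_compose[OF d this]
    have d0: "((\<lambda>Q. (f \<circ> inv_into U \<phi>) ((\<phi> \<circ> q) Q)) has_derivative (\<lambda>v. 0)) (at P within S \<inter> T)" .
    have "(F has_derivative (\<lambda>v. 0)) (at P within S \<inter> T)"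
    proof (rule has_derivative_transform[OF PT _ d0])
      fix Q assume "Q \<in> S \<inter> T"
      then have "Q \<in> S" "q Q \<in> U" using T(2) by auto
      then show "F Q = (f \<circ> inv_into U \<phi>) ((\<phi> \<circ> q) Q)"
        using inv_into_f_f[OF chart(3)[OF U(1)]] F by simp
    qed
    then have kernel: "F' v = 0" if "\<forall>j\<in>J. D j v = 0" for v
      using tangent_derivative_unique[OF has_derivative_at_withinI[OF F'], of "\<lambda>v. 0" "S \<inter> T" v]
        tangent[OF T(1)] PT that by auto
    have "F' v = (\<Sum>j\<in>J. F' (w j) * D j v)" for v
      by (rule multipliers[OF lF' kernel])
    then show "\<exists>\<mu>. \<forall>v. F' v = (\<Sum>j\<in>J. \<mu> j * D j v)" by (intro exI allI)
  next
    assume "\<exists>\<mu>. \<forall>v. F' v = (\<Sum>j\<in>J. \<mu> j * D j v)"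
    then obtain \<mu> where \<mu>: "\<And>v. F' v = (\<Sum>j\<in>J. \<mu> j * D j v)" by blast
    have "q P \<in> topspace X" using P X(1) by blast
    then obtain U \<phi> where U: "(U, \<phi>) \<in> \<A>" "q P \<in> U"
      using atlas unfolding smooth_atlas_def by blast
    obtain T where T: "open T" "{Q \<in> S. q Q \<in> U} = S \<inter> T" using chart(1)[OF U(1)] by blast
    have PT: "P \<in> S \<inter> T" using P U(2) T(2) by blast
    obtain d where d: "((\<phi> \<circ> q) has_derivative d) (at P within S \<inter> T)" "d ` tangent_space (S \<inter> T) P = E"
      and smooth: "smooth_on (S \<inter> T) (\<phi> \<circ> q)"
      using subm U(1) PT unfolding smooth_submersion_def Let_def T(2)[symmetric] by blast
    \<comment> \<open>\<open>local_section\<close> needs a map on an open set of the ambient space,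
      so the chart composed with \<open>q\<close> is replaced by a local smooth extension
      \<open>G\<close>.\<close>
    obtain V G where V: "open V" "P \<in> V" "\<And>k. C_k_on k V G"
      and G: "\<And>Q. Q \<in> V \<inter> (S \<inter> T) \<Longrightarrow> G Q = (\<phi> \<circ> q) Q"
      using smooth PT unfolding smooth_on_def by metis
    have contG: "continuous_on V G" using V(3)[of 0] by simp
    have "G differentiable (at P)" using V(3)[of "Suc 0"] V(2) by simp
    then obtain G' where G': "(G has_derivative G') (at P)" unfolding differentiable_def by blast
    define Z where "Z = V \<inter> T \<inter> ball P \<epsilon>"
    have Z: "open Z" "P \<in> Z" using V T PT S(1) by (auto simp: Z_def)
    have ZS: "Q \<in> V \<inter> (S \<inter> T)" if "Q \<in> Z" "\<forall>j\<in>J. L j Q = L j P" for Q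
      using that S(2)[of Q] by (auto simp: Z_def dist_norm norm_minus_commute)
    have PV: "P \<in> V \<inter> (S \<inter> T)" using PT V(2) by blast
    have GP: "G P = \<phi> (q P)" using G[OF PV] by simp
    have subE: "subspace E" using atlas unfolding smooth_atlas_def by blast
    \<comment> \<open>The submersion property concerns the derivative \<open>d\<close> within
      \<open>S\<close>; on tangent vectors it agrees with the ambient derivative
      \<open>G'\<close>.\<close>
    have E: "E \<subseteq> G' ` {v. \<forall>j\<in>J. D j v = 0}"
    proof
      fix e assume "e \<in> E"
      then obtain v where v: "v \<in> tangent_space (S \<inter> T) P" "e = d v" using d(2) by blast
      have tV: "tangent_space (S \<inter> T) P = tangent_space (S \<inter> (T \<inter> V)) P"
        using tangent[OF T(1)] tangent[of "T \<inter> V"] T(1) V(1) PV by auto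
      have W: "S \<inter> (T \<inter> V) \<subseteq> S \<inter> T" "P \<in> S \<inter> (T \<inter> V)" using PV by auto
      have "((\<phi> \<circ> q) has_derivative G') (at P within S \<inter> (T \<inter> V))"
        by (rule has_derivative_transform[OF W(2) _ has_derivative_at_withinI[OF G']]) (use G in auto)
      then have "d v = G' v"
        using tangent_derivative_unique[OF has_derivative_subset[OF d(1) W(1)]] v(1) W(2) unfolding tV by blast
      then show "e \<in> G' ` {v. \<forall>j\<in>J. D j v = 0}" using v tangent[OF T(1)] PT by auto
    qed
    have GE: "G Q \<in> E" if "Q \<in> Z" "\<forall>j\<in>J. L j Q = L j P" for Q
    proof -
      have "q Q \<in> U" using ZS[OF that] T(2) by blast
      then show ?thesis using G[OF ZS[OF that]] chart(4)[OF U(1)] by auto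
    qed
    have "continuous_on Z G" using contG by (rule continuous_on_subset) (simp add: Z_def Int_assoc)
    from local_section[OF Z this G' subE E GE]
    obtain C \<delta> where C: "C > 0" "\<delta> > 0" "\<And>y. y \<in> E \<Longrightarrow> norm (y - G P) < \<delta> \<Longrightarrow>
        \<exists>Q\<in>Z. (\<forall>j\<in>J. L j Q = L j P) \<and> G Q = y \<and> norm (Q - P) \<le> C * norm (y - G P)"
      by blast
    define B where "B = (\<lambda>Q. F Q - (\<Sum>j\<in>J. \<mu> j * L j Q))"
    have "(B has_derivative (\<lambda>v. F' v - (\<Sum>j\<in>J. \<mu> j * D j v))) (at P)"
      unfolding B_def
      by (rule has_derivative_diff[OF F' has_derivative_sum]) (rule has_derivative_mult_right[OF derivative])
    then have B': "(B has_derivative (\<lambda>v. 0)) (at P)" by (simp add: \<mu>)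
    have "((f \<circ> inv_into U \<phi>) has_derivative (\<lambda>_. 0)) (at (\<phi> (q P)) within \<phi> ` U)"
      unfolding has_derivative_within_alt
    proof (intro conjI allI impI)
      show "bounded_linear (\<lambda>_ :: 'e. 0 :: real)" by (rule bounded_linear_zero)
      fix e :: real assume "e > 0"
      \<comment> \<open>The division by \<open>C\<close> compensates the factor lost in the lift
        \<open>norm (Q - P) \<le> C * norm (y - G P)\<close>.\<close>
      then have "e / C > 0" using C(1) by simp
      then obtain \<delta>' where \<delta>': "\<delta>' > 0" "\<And>Q. norm (Q - P) < \<delta>' \<Longrightarrow> norm (B Q - B P - 0) \<le> e / C * norm (Q - P)"
        using B' unfolding has_derivative_at_alt by metis
      show "\<exists>r>0. \<forall>y\<in>\<phi> ` U. norm (y - \<phi> (q P)) < r \<longrightarrow>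
          norm ((f \<circ> inv_into U \<phi>) y - (f \<circ> inv_into U \<phi>) (\<phi> (q P)) - 0) \<le> e * norm (y - \<phi> (q P))"
      proof (intro exI[of _ "min \<delta> (\<delta>' / C)"] conjI ballI impI)
        show "min \<delta> (\<delta>' / C) > 0" using C(1,2) \<delta>'(1) by simp
        fix y assume y: "y \<in> \<phi> ` U" "norm (y - \<phi> (q P)) < min \<delta> (\<delta>' / C)"
        then have "y \<in> E" "norm (y - G P) < \<delta>" using chart(4)[OF U(1)] by (auto simp: GP)
        then obtain Q where Q: "Q \<in> Z" "\<forall>j\<in>J. L j Q = L j P" "G Q = y" "norm (Q - P) \<le> C * norm (y - G P)"
          using C(3) by blast
        have QS: "Q \<in> V \<inter> (S \<inter> T)" by (rule ZS[OF Q(1,2)])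
        then have qQ: "q Q \<in> U" "Q \<in> S" using T(2) by auto
        have yq: "y = \<phi> (q Q)" using G[OF QS] Q(3) by simp
        have inv: "inv_into U \<phi> y = q Q" "inv_into U \<phi> (\<phi> (q P)) = q P"
          unfolding yq using inv_into_f_f[OF chart(3)[OF U(1)]] qQ(1) U(2) by auto
        have "C * norm (y - G P) < \<delta>'" using y(2) C(1) by (simp add: GP pos_less_divide_eq mult.commute)
        then have "norm (B Q - B P - 0) \<le> e / C * norm (Q - P)" using Q(4) by (intro \<delta>'(2)) simp
        also have "\<dots> \<le> e / C * (C * norm (y - G P))"
          using Q(4) \<open>e / C > 0\<close> by (intro mult_left_mono) auto
        also have "\<dots> = e * norm (y - \<phi> (q P))" using C(1) by (simp add: GP)
        also have "B Q - B P = F Q - F P"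
          using Q(2) by (simp add: B_def cong: sum.cong)
        also have "F Q - F P = (f \<circ> inv_into U \<phi>) y - (f \<circ> inv_into U \<phi>) (\<phi> (q P))"
          using inv F[OF qQ(2)] F[OF P] by simp
        finally show "norm ((f \<circ> inv_into U \<phi>) y - (f \<circ> inv_into U \<phi>) (\<phi> (q P)) - 0) \<le> e * norm (y - \<phi> (q P))" .
      qed
    qed
    then show "critical_point \<A> f (q P)" using U unfolding critical_point_def by blast
  qed
qed

end

section \<open>Polygons and the Lagrange equations\<close>

lemma vertex_add_card: "vertex P (i + CARD('n)) = vertex (P :: 'n::finite polygon) i"
  unfolding vertex_def by (rule arg_cong[of _ _ "($) P"]) (transfer, simp)

lemma vertex_card: "vertex P CARD('n) = vertex (P :: 'n::finite polygon) 0"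
  using vertex_add_card[of P 0] by simp

lemma periodic_mod:
  fixes \<alpha> :: "nat \<Rightarrow> 'a"
  assumes "\<And>i. \<alpha> (i + n) = \<alpha> i"
  shows "\<alpha> (i mod n) = \<alpha> i"
proof -
  have "\<alpha> (k + m * n) = \<alpha> k" for k m
  proof (induction m)
    case (Suc m)
    then show ?case using assms[of "k + m * n"] by (simp add: algebra_simps)
  qed simp
  from this[of "i mod n" "i div n"] show ?thesis by simp
qed

lemma polygon_with_vertices:
  fixes \<alpha> :: "nat \<Rightarrow> complex"
  assumes "\<And>i. \<alpha> (i + CARD('n::finite)) = \<alpha> i"
  obtains v :: "'n::finite polygon" where "\<And>i. vertex v i = \<alpha> i"
proof
  fix i
  have "to_int_mod_ring (of_int_mod_ring (int i) :: 'n mod_ring) = int i mod int CARD('n)"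
    by transfer simp
  then show "vertex (\<chi> k. \<alpha> (nat (to_int_mod_ring k)) :: 'n polygon) i = \<alpha> i"
    using periodic_mod[of \<alpha>, OF assms, of i] by (simp add: vertex_def nat_mod_distrib)
qed

lemma bounded_linear_vertex: "bounded_linear (\<lambda>P. vertex P i)"
  unfolding vertex_def by (rule bounded_linear_vec_nth)

lemma vertex_add: "vertex (P + Q) i = vertex P i + vertex Q i"
  and vertex_scaleR: "vertex (t *\<^sub>R P) i = t *\<^sub>R vertex P i"
  by (simp_all add: vertex_def)

lemma norm_vertex_le: "cmod (vertex P i) \<le> norm P"
  unfolding vertex_def by (rule Finite_Cartesian_Product.norm_nth_le)

lemma sum_shift_periodic:
  fixes f :: "nat \<Rightarrow> 'a::ab_group_add"
  assumes "f n = f 0"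
  shows "(\<Sum>i<n. f (Suc i)) = (\<Sum>i<n. f i)"
  using sum_lessThan_telescope[of f n] assms by (simp add: sum_subtractf)

text \<open>Testing the functional on the polygon made of the coefficients themselves gives a
  vanishing sum of squares.\<close>

lemma functional_zero_iff:
  fixes \<alpha> :: "nat \<Rightarrow> complex"
  assumes per: "\<And>i. \<alpha> (i + CARD('n::finite)) = \<alpha> i"
  shows "(\<forall>v :: 'n polygon. (\<Sum>i<CARD('n). \<alpha> i \<bullet> vertex v (Suc i)) = 0) \<longleftrightarrow> (\<forall>i<CARD('n). \<alpha> i = 0)"
proof
  assume *: "\<forall>v :: 'n polygon. (\<Sum>i<CARD('n). \<alpha> i \<bullet> vertex v (Suc i)) = 0"
  \<comment> \<open>The pairing involves vertex \<open>Suc i\<close>, so the test polygon is shifted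
    back by one place, that is forward by \<open>k = CARD('n) - 1\<close>.\<close>
  obtain k where k: "CARD('n) = Suc k" by (metis not0_implies_Suc zero_less_card_finite less_numeral_extra(3))
  have "\<alpha> (i + CARD('n) + k) = \<alpha> (i + k)" for i
    using per[of "i + k"] by (simp add: algebra_simps)
  from polygon_with_vertices[of "\<lambda>i. \<alpha> (i + k)", OF this]
  obtain v :: "'n polygon" where v: "\<And>i. vertex v i = \<alpha> (i + k)" by blast
  have "vertex v (Suc i) = \<alpha> i" for i using v[of "Suc i"] per[of i] by (simp add: k)
  then have "(\<Sum>i<CARD('n). \<alpha> i \<bullet> \<alpha> i) = 0" using *[rule_format, of v] by simp
  then show "\<forall>i<CARD('n). \<alpha> i = 0"
    by (subst (asm) sum_nonneg_eq_0_iff) auto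
qed simp

definition edge :: "'n::finite polygon \<Rightarrow> nat \<Rightarrow> complex" where
  "edge P i = vertex P (Suc i) - vertex P i"

lemma side_length_edge: "side_length P i = cmod (edge P i)"
  by (simp add: side_length_def edge_def)

lemma bounded_linear_edge: "bounded_linear (\<lambda>P. edge P i)"
  unfolding edge_def by (intro bounded_linear_sub bounded_linear_vertex)

lemma edge_add_card: "edge P (i + CARD('n)) = edge (P :: 'n::finite polygon) i"
  using vertex_add_card[of P "Suc i"] by (simp add: edge_def vertex_add_card)

lemma norm_edge_le: "cmod (edge P i) \<le> 2 * norm P"
  using norm_triangle_ineq4[of "vertex P (Suc i)" "vertex P i"] norm_vertex_le[of P i]
    norm_vertex_le[of P "Suc i"] by (simp add: edge_def)

lemma inner_ii_mult: "(\<i> * a) \<bullet> b = Re a * Im b - Re b * Im a"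
  by (simp add: inner_complex_def)

lemma oriented_area_inner:
  "oriented_area P = 1 / 2 * (\<Sum>i<CARD('n). (\<i> * vertex P i) \<bullet> vertex (P :: 'n::finite polygon) (Suc i))"
  by (simp add: oriented_area_def inner_ii_mult)

text \<open>The partial gradient with respect to vertex \<open>Suc i\<close>: half the diagonal that
  skips this vertex, turned by a right angle.\<close>

definition area_gradient :: "'n::finite polygon \<Rightarrow> nat \<Rightarrow> complex" where
  "area_gradient P i = \<i> * (vertex P i - vertex P (Suc (Suc i))) / 2"

lemma has_derivative_oriented_area:
  fixes P :: "'n::finite polygon"
  shows "(oriented_area has_derivative
    (\<lambda>v. \<Sum>i<CARD('n). area_gradient P i \<bullet> vertex v (Suc i))) (at P)"
proof -
  have vd: "((\<lambda>Q. vertex Q i) has_derivative (\<lambda>v. vertex v i)) (at P)" for i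
    by (rule bounded_linear_imp_has_derivative[OF bounded_linear_vertex])
  have "((\<lambda>Q :: 'n polygon. 1 / 2 * (\<Sum>i<CARD('n). (\<i> * vertex Q i) \<bullet> vertex Q (Suc i))) has_derivative
     (\<lambda>v. 1 / 2 * (\<Sum>i<CARD('n). (\<i> * vertex P i) \<bullet> vertex v (Suc i) + (\<i> * vertex v i) \<bullet> vertex P (Suc i)))) (at P)"
    by (intro has_derivative_mult_right has_derivative_sum has_derivative_inner vd)
  moreover have "1 / 2 * (\<Sum>i<CARD('n). (\<i> * vertex P i) \<bullet> vertex v (Suc i) + (\<i> * vertex v i) \<bullet> vertex P (Suc i)) =
      (\<Sum>i<CARD('n). area_gradient P i \<bullet> vertex v (Suc i))" for v :: "'n polygon"
  proof -
    \<comment> \<open>A cyclic shift makes both halves of the product rule test the same vertex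
      \<open>Suc i\<close>.\<close>
    have "(\<Sum>i<CARD('n). (\<i> * vertex v i) \<bullet> vertex P (Suc i)) =
        (\<Sum>i<CARD('n). (\<i> * vertex v (Suc i)) \<bullet> vertex P (Suc (Suc i)))"
      by (rule sum_shift_periodic[symmetric])
        (use vertex_add_card[of P 1] in \<open>simp add: vertex_card\<close>)
    then have "1 / 2 * (\<Sum>i<CARD('n). (\<i> * vertex P i) \<bullet> vertex v (Suc i) + (\<i> * vertex v i) \<bullet> vertex P (Suc i)) =
        (\<Sum>i<CARD('n). 1 / 2 * ((\<i> * vertex P i) \<bullet> vertex v (Suc i) + (\<i> * vertex v (Suc i)) \<bullet> vertex P (Suc (Suc i))))"
      by (simp only: sum.distrib sum_distrib_left[symmetric])
    also have "\<dots> = (\<Sum>i<CARD('n). area_gradient P i \<bullet> vertex v (Suc i))"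
      by (rule sum.cong) (auto simp: area_gradient_def inner_complex_def field_simps)
    finally show ?thesis .
  qed
  ultimately show ?thesis by (simp add: oriented_area_inner[abs_def])
qed

lemma has_derivative_side_length:
  assumes "edge P i \<noteq> 0"
  shows "((\<lambda>Q. side_length Q i) has_derivative (\<lambda>v. sgn (edge P i) \<bullet> edge v i)) (at P)"
proof -
  have "((\<lambda>Q. cmod (edge Q i)) has_derivative (\<lambda>v. edge v i \<bullet> sgn (edge P i))) (at P)"
    by (rule has_derivative_compose[OF bounded_linear_imp_has_derivative[OF bounded_linear_edge]
        has_derivative_norm[OF assms]])
  then show ?thesis by (simp add: side_length_edge inner_commute)
qed

definition block_derivative :: "necklace \<Rightarrow> 'n::finite polygon \<Rightarrow> nat \<Rightarrow> 'n polygon \<Rightarrow> real" where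
  "block_derivative N P j v = (\<Sum>i\<in>block N j. sgn (edge P i) \<bullet> edge v i)"

lemma has_derivative_block_length:
  assumes "\<And>i. i \<in> block N j \<Longrightarrow> edge P i \<noteq> 0"
  shows "(block_length N j has_derivative block_derivative N P j) (at P)"
proof -
  have "((\<lambda>Q. \<Sum>i\<in>block N j. side_length Q i) has_derivative
      (\<lambda>v. \<Sum>i\<in>block N j. sgn (edge P i) \<bullet> edge v i)) (at P)"
    by (rule has_derivative_sum) (rule has_derivative_side_length[OF assms])
  then show ?thesis by (simp add: block_length_def[abs_def] block_derivative_def[abs_def])
qed

lemma continuous_block_length: "continuous_on UNIV (block_length N j)"
proof -
  have "continuous_on UNIV (\<lambda>Q. \<Sum>i\<in>block N j. cmod (edge Q i))"
    by (intro continuous_on_sum continuous_on_norm bounded_linear.continuous_on[OF bounded_linear_edge] continuous_on_id)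
  then show ?thesis by (simp add: block_length_def[abs_def] side_length_edge)
qed

section \<open>Beads and their sides\<close>

lemma total_number_take_Suc:
  "j < length N \<Longrightarrow> total_number (take (Suc j) N) = total_number (take j N) + fst (N ! j)"
  by (simp add: total_number_def take_Suc_conv_app_nth)

lemma total_number_take_mono: "i \<le> j \<Longrightarrow> total_number (take i N) \<le> total_number (take j N)"
proof -
  assume "i \<le> j"
  then have "take j N = take i N @ take (j - i) (drop i N)" by (metis le_add_diff_inverse take_add)
  then show ?thesis by (simp add: total_number_def)
qed

lemma block_subset:
  assumes "j < length N" "i \<in> block N j"
  shows "i < total_number N"
  using assms total_number_take_mono[of "Suc j" "length N" N] by (auto simp: block_def)

lemma sum_blocks:
  "m \<le> length N \<Longrightarrow> (\<Sum>j<m. \<Sum>i\<in>block N j. f i) = (\<Sum>i<total_number (take m N). f i)"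
proof (induction m)
  case 0
  show ?case by (simp add: total_number_def)
next
  case (Suc m)
  then show ?case
    using sum.atLeastLessThan_concat[of 0 "total_number (take m N)" "total_number (take (Suc m) N)" f]
      total_number_take_mono[of m "Suc m" N]
    by (simp add: block_def atLeast0LessThan)
qed

text \<open>Inverse to \<open>block\<close> on valid side indices; it turns a double sum over beads
  and their sides into one sum over sides whose multiplier is constant on beads.\<close>

definition bead :: "necklace \<Rightarrow> nat \<Rightarrow> nat" where
  "bead N i = (LEAST j. i < total_number (take (Suc j) N))"

lemma bead_block: "i \<in> block N j \<Longrightarrow> bead N i = j"
  unfolding bead_def
proof (rule Least_equality)
  assume i: "i \<in> block N j"
  then show "i < total_number (take (Suc j) N)" by (simp add: block_def)
  fix k assume "i < total_number (take (Suc k) N)"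
  then show "j \<le> k"
    using i total_number_take_mono[of "Suc k" j N] by (force simp: block_def)
qed

lemma bead_total:
  assumes "i < total_number N"
  shows "bead N i < length N" "i \<in> block N (bead N i)"
proof -
  have "\<exists>j<m. i \<in> block N j" if "i < total_number (take m N)" "m \<le> length N" for m
    using that
  proof (induction m)
    case 0
    then show ?case by (simp add: total_number_def)
  next
    case (Suc m)
    then show ?case
      by (cases "i < total_number (take m N)") (auto simp: block_def less_Suc_eq not_less)
  qed
  from this[of "length N"] obtain j where "j < length N" "i \<in> block N j" using assms by auto
  then show "bead N i < length N" "i \<in> block N (bead N i)" using bead_block by simp_all
qed

lemma sum_multipliers:
  "(\<Sum>j<length N. \<mu> j * (\<Sum>i\<in>block N j. f i)) = (\<Sum>i<total_number N. \<mu> (bead N i) * (f i :: real))"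
proof -
  have "(\<Sum>j<length N. \<mu> j * (\<Sum>i\<in>block N j. f i)) = (\<Sum>j<length N. \<Sum>i\<in>block N j. \<mu> (bead N i) * f i)"
    by (simp add: sum_distrib_left bead_block cong: sum.cong)
  then show ?thesis using sum_blocks[of "length N" N] by simp
qed

section \<open>Points on the perpendicular bisector of a side\<close>

text \<open>For \<open>p \<noteq> q\<close>, \<open>s\<close> is the signed height over the
  midpoint, positive to the left of the direction from \<open>p\<close> to \<open>q\<close>.\<close>

definition bisector_point :: "complex \<Rightarrow> complex \<Rightarrow> real \<Rightarrow> complex" where
  "bisector_point p q s = (p + q) / 2 + \<i> * complex_of_real s * sgn (q - p)"

lemma bisector_point_minus:
  "bisector_point p q s - p = sgn (q - p) * Complex (dist p q / 2) s"
  "bisector_point p q s - q = sgn (q - p) * Complex (- dist p q / 2) s"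
proof -
  define u l where "u = sgn (q - p)" and "l = dist p q"
  have q: "q = p + u * complex_of_real l"
    by (simp add: u_def l_def sgn_eq dist_norm norm_minus_commute)
  have C: "Complex x s = complex_of_real x + \<i> * complex_of_real s" for x
    by (simp add: complex_eq_iff)
  have b: "bisector_point p q s = (p + q) / 2 + \<i> * complex_of_real s * u"
    by (simp add: bisector_point_def u_def)
  have mid: "(p + q) / 2 = p + u * complex_of_real l / 2" "(p + q) / 2 = q - u * complex_of_real l / 2"
    by (subst q, simp add: field_simps) (use q in \<open>simp add: field_simps\<close>)
  show "bisector_point p q s - p = sgn (q - p) * Complex (dist p q / 2) s"
    "bisector_point p q s - q = sgn (q - p) * Complex (- dist p q / 2) s"
    unfolding b u_def[symmetric] l_def[symmetric] C
    by (simp add: mid(1) algebra_simps, simp add: mid(2) algebra_simps)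
qed

lemma dist_bisector_point:
  assumes "p \<noteq> q"
  shows "dist (bisector_point p q s) p = sqrt ((dist p q / 2)\<^sup>2 + s\<^sup>2)"
    and "dist (bisector_point p q s) q = sqrt ((dist p q / 2)\<^sup>2 + s\<^sup>2)"
  using assms unfolding dist_norm[of "bisector_point p q s"] bisector_point_minus norm_mult
  by (simp_all add: norm_sgn complex_norm)

text \<open>Equidistance makes \<open>c - m\<close> orthogonal to the side, \<open>m\<close> being
  the midpoint. Rotating the side onto the real axis by \<open>cnj u\<close> makes this vector
  purely imaginary, and its imaginary part is the height.\<close>

lemma equidistant_imp_bisector_point:
  assumes "p \<noteq> q" "dist c p = dist c q"
  obtains s where "c = bisector_point p q s"
proof
  define u where "u = sgn (q - p)"
  define m where "m = (p + q) / 2"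
  define w where "w = cnj u * (c - m)"
  have u: "u * cnj u = 1"
    using assms(1) by (simp add: u_def complex_norm_square[symmetric] norm_sgn)
  have e: "q - p = complex_of_real (dist p q) * u"
    by (simp add: u_def sgn_eq dist_norm norm_minus_commute)
  have d: "dist p q > 0" using assms(1) by simp
  have "(dist c p)\<^sup>2 = (dist c q)\<^sup>2" using assms(2) by simp
  then have "(c - p) \<bullet> (c - p) = (c - q) \<bullet> (c - q)"
    unfolding dist_norm power2_norm_eq_inner .
  moreover have "(c - m) \<bullet> (q - p) = ((c - p) \<bullet> (c - p) - (c - q) \<bullet> (c - q)) / 2"
    by (simp add: m_def inner_complex_def field_simps)
  moreover have "(c - m) \<bullet> (q - p) = dist p q * Re w"
    unfolding e by (simp add: w_def inner_complex_def algebra_simps)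
  ultimately have "dist p q * Re w = 0" by simp
  then have "Re w = 0" using d by (metis less_irrefl mult_eq_0_iff)
  then have "w = \<i> * complex_of_real (Im w)" by (simp add: complex_eq_iff)
  then have "u * w = \<i> * complex_of_real (Im w) * u" by simp
  moreover have uw: "u * w = c - m"
    using u by (simp add: w_def flip: mult.assoc)
  ultimately have "c - m = \<i> * complex_of_real (Im w) * u" by simp
  then have "c = m + \<i> * complex_of_real (Im w) * u" by (metis add.commute diff_add_cancel)
  then show "c = bisector_point p q (Im w)"
    by (simp only: bisector_point_def u_def m_def)
qed

text \<open>Replaces angles by the sign of an imaginary part. The degenerate ratio 0, obtained also
  when a vertex equals the centre, fits because \<open>Arg 0 = 0\<close>.\<close>

lemma side_orientation_ratio:
  "side_orientation c P i =
    (let y = Im ((vertex P (i + 1) - c) / (vertex P i - c)) in if y > 0 then 1 else if y = 0 then 0 else - 1)"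
proof -
  define z where "z = (vertex P (i + 1) - c) / (vertex P i - c)"
  have "Arg z \<in> {0<..<pi} \<longleftrightarrow> Im z > 0"
    using Arg_lt_pi[of z] by auto
  moreover have "Arg z \<in> {0, pi} \<longleftrightarrow> Im z = 0"
    using Arg_eq_0_pi[of z] by (auto simp: complex_is_Real_iff)
  ultimately show ?thesis
    unfolding side_orientation_def central_angle_def Let_def z_def[symmetric] by simp
qed

text \<open>The unit direction of the side cancels in the ratio, and the imaginary part left over is
  the height \<open>s\<close> times a positive factor.\<close>

lemma side_orientation_bisector_point:
  assumes "edge P i \<noteq> 0" "c = bisector_point (vertex P i) (vertex P (Suc i)) s"
  shows "side_orientation c P i = (if s > 0 then 1 else if s = 0 then 0 else - 1)"
proof -
  define p q where "p = vertex P i" and "q = vertex P (Suc i)"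
  have pq: "p \<noteq> q" using assms(1) by (auto simp: edge_def p_def q_def)
  have "(q - c) / (p - c) = (c - q) / (c - p)" by (metis minus_diff_eq minus_divide_divide)
  also have "\<dots> = Complex (- dist p q / 2) s / Complex (dist p q / 2) s"
    using pq assms(2) unfolding p_def[symmetric] q_def[symmetric]
    by (simp add: bisector_point_minus sgn_eq_0_iff)
  finally have "Im ((q - c) / (p - c)) = dist p q * s / ((dist p q / 2)\<^sup>2 + s\<^sup>2)"
    by (simp add: Im_divide)
  moreover have "(dist p q / 2)\<^sup>2 + s\<^sup>2 > 0" "dist p q > 0"
    using pq by (simp_all add: sum_power2_gt_zero_iff)
  ultimately have "Im ((q - c) / (p - c)) > 0 \<longleftrightarrow> s > 0" "Im ((q - c) / (p - c)) = 0 \<longleftrightarrow> s = 0"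
    by (simp_all add: zero_less_divide_iff zero_less_mult_iff)
  then show ?thesis
    unfolding side_orientation_ratio Let_def by (simp add: p_def q_def)
qed

text \<open>Summation by parts moves the difference from the edges of the test polygon to the
  vectors \<open>u i\<close>. The total coefficient at vertex \<open>Suc i\<close> is then
  \<open>\<i> * (C i - C (Suc i))\<close>.\<close>

lemma lagrange_iff_common_centre:
  fixes P :: "'n::finite polygon"
  assumes per: "\<And>i. \<Lambda> (i + CARD('n)) = \<Lambda> i"
  defines "C \<equiv> \<lambda>i. bisector_point (vertex P i) (vertex P (Suc i)) (\<Lambda> i)"
  shows "(\<forall>v :: 'n polygon. (\<Sum>i<CARD('n). area_gradient P i \<bullet> vertex v (Suc i)) =
      (\<Sum>i<CARD('n). \<Lambda> i * (sgn (edge P i) \<bullet> edge v i))) \<longleftrightarrow>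
    (\<forall>i<CARD('n). C (Suc i) = C i)"
proof -
  define u where "u = (\<lambda>i. \<Lambda> i *\<^sub>R sgn (edge P i))"
  have u_per: "u (i + CARD('n)) = u i" for i by (simp add: u_def per edge_add_card)
  have v_per: "vertex P (Suc (i + CARD('n))) = vertex P (Suc i)" for i
    using vertex_add_card[of P "Suc i"] by simp
  have C_per: "C (i + CARD('n)) = C i" for i
    by (simp add: C_def per vertex_add_card v_per)
  have C_eq: "C i = (vertex P i + vertex P (Suc i)) / 2 + \<i> * u i" for i
    by (simp add: C_def bisector_point_def u_def edge_def scaleR_conv_of_real)
  have split: "(\<Sum>i<CARD('n). \<Lambda> i * (sgn (edge P i) \<bullet> edge v i)) =
      (\<Sum>i<CARD('n). (u i - u (Suc i)) \<bullet> vertex v (Suc i))" for v :: "'n polygon"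
  proof -
    have "(\<Sum>i<CARD('n). u (Suc i) \<bullet> vertex v (Suc i)) = (\<Sum>i<CARD('n). u i \<bullet> vertex v i)"
      by (rule sum_shift_periodic) (use u_per[of 0] in \<open>simp add: vertex_card\<close>)
    then show ?thesis
      by (simp add: u_def edge_def inner_diff_left inner_diff_right sum_subtractf right_diff_distrib)
  qed
  have grad: "area_gradient P i - (u i - u (Suc i)) = \<i> * (C i - C (Suc i))" for i
    by (simp add: C_eq area_gradient_def field_simps)
  have zero_iff: "\<i> * (C i - C (Suc i)) = 0 \<longleftrightarrow> C (Suc i) = C i" for i by auto
  have per2: "\<i> * (C (i + CARD('n)) - C (Suc (i + CARD('n)))) = \<i> * (C i - C (Suc i))" for i
    using C_per[of "Suc i"] by (simp add: C_per)
  have "(\<forall>v :: 'n polygon. (\<Sum>i<CARD('n). area_gradient P i \<bullet> vertex v (Suc i)) =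
      (\<Sum>i<CARD('n). \<Lambda> i * (sgn (edge P i) \<bullet> edge v i))) \<longleftrightarrow>
    (\<forall>v :: 'n polygon. (\<Sum>i<CARD('n). (\<i> * (C i - C (Suc i))) \<bullet> vertex v (Suc i)) = 0)"
    unfolding split grad[symmetric] by (simp add: inner_diff_left sum_subtractf)
  also have "\<dots> \<longleftrightarrow> (\<forall>i<CARD('n). \<i> * (C i - C (Suc i)) = 0)"
    by (rule functional_zero_iff[of "\<lambda>i. \<i> * (C i - C (Suc i))", OF per2])
  also have "\<dots> \<longleftrightarrow> (\<forall>i<CARD('n). C (Suc i) = C i)"
    unfolding zero_iff ..
  finally show ?thesis .
qed

definition inscribed_necklace :: "necklace \<Rightarrow> 'n::finite polygon \<Rightarrow> bool" where
  "inscribed_necklace N P \<longleftrightarrow>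
    (\<exists>c r. r > 0 \<and> (\<forall>i<CARD('n). dist c (vertex P i) = r) \<and>
       (\<forall>j<length N. \<forall>i\<^sub>1\<in>block N j. \<forall>i\<^sub>2\<in>block N j.
          side_orientation c P i\<^sub>1 = side_orientation c P i\<^sub>2)) \<and>
    (\<forall>j<length N. \<forall>i\<in>block N j. side_length P i = snd (N ! j) / real (fst (N ! j)))"

text \<open>By Pythagoras, a common centre gives
  \<open>side_length\<^sup>2 = 4 * (r\<^sup>2 - \<mu>\<^sup>2)\<close> on a bead; the sides of a
  bead are then equal, and its prescribed total length fixes their value. Conversely, length and
  radius give the height up to sign and the orientation gives the sign, so the height is constant on
  each bead.\<close>

lemma lagrange_iff_inscribed_necklace:
  fixes P :: "'n::finite polygon"
  assumes N: "is_necklace N" and n: "CARD('n) = total_number N"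
    and P: "P \<in> configurations N" and e: "\<And>i. edge P i \<noteq> 0"
  shows "(\<exists>\<mu>. \<forall>v :: 'n polygon. (\<Sum>i<CARD('n). area_gradient P i \<bullet> vertex v (Suc i)) =
      (\<Sum>j<length N. \<mu> j * block_derivative N P j v)) \<longleftrightarrow> inscribed_necklace N P"
proof -
  \<comment> \<open>The reduction modulo \<open>CARD('n)\<close> makes the multipliers periodic,
    which covers the closing side, where the index \<open>Suc i\<close> reaches
    \<open>CARD('n)\<close>.\<close>
  define \<Lambda> where "\<Lambda> = (\<lambda>\<mu> :: nat \<Rightarrow> real. \<lambda>i. \<mu> (bead N (i mod CARD('n))))"
  define C where "C = (\<lambda>\<mu> i. bisector_point (vertex P i) (vertex P (Suc i)) (\<Lambda> \<mu> i))"
  have ne: "vertex P i \<noteq> vertex P (Suc i)" for i using e[of i] by (auto simp: edge_def)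
  have len: "dist (vertex P i) (vertex P (Suc i)) = side_length P i" for i
    by (simp add: side_length_def dist_norm norm_minus_commute)
  have \<Lambda>_block: "\<Lambda> \<mu> i = \<mu> j" if "j < length N" "i \<in> block N j" for \<mu> i j
    using block_subset[OF that] bead_block[OF that(2)] by (simp add: \<Lambda>_def n)
  have \<Lambda>_per: "\<Lambda> \<mu> (i + CARD('n)) = \<Lambda> \<mu> i" for \<mu> i by (simp add: \<Lambda>_def)
  have iff: "(\<forall>v :: 'n polygon. (\<Sum>i<CARD('n). area_gradient P i \<bullet> vertex v (Suc i)) =
      (\<Sum>j<length N. \<mu> j * block_derivative N P j v)) \<longleftrightarrow> (\<forall>i<CARD('n). C \<mu> (Suc i) = C \<mu> i)" for \<mu>
  proof -
    have eq: "(\<Sum>j<length N. \<mu> j * block_derivative N P j v) =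
        (\<Sum>i<CARD('n). \<Lambda> \<mu> i * (sgn (edge P i) \<bullet> edge v i))" for v :: "'n polygon"
      unfolding block_derivative_def sum_multipliers n[symmetric]
      by (rule sum.cong[OF refl]) (simp add: \<Lambda>_def)
    show ?thesis
      unfolding eq C_def by (rule lagrange_iff_common_centre[of "\<Lambda> \<mu>", OF \<Lambda>_per])
  qed
  have centre: "(\<exists>\<mu>. \<forall>i<CARD('n). C \<mu> (Suc i) = C \<mu> i) \<longleftrightarrow> inscribed_necklace N P"
  proof
    assume "\<exists>\<mu>. \<forall>i<CARD('n). C \<mu> (Suc i) = C \<mu> i"
    then obtain \<mu> where \<mu>: "\<And>i. i < CARD('n) \<Longrightarrow> C \<mu> (Suc i) = C \<mu> i" by blast
    define c where "c = C \<mu> 0"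
    have c: "c = bisector_point (vertex P i) (vertex P (Suc i)) (\<Lambda> \<mu> i)" if "i < CARD('n)" for i
    proof -
      have "i < CARD('n) \<Longrightarrow> c = C \<mu> i"
        by (induction i) (use \<mu> in \<open>auto simp: c_def\<close>)
      then show ?thesis using that by (simp add: C_def)
    qed
    define r where "r = dist c (vertex P 0)"
    have d: "dist c (vertex P i) = sqrt ((side_length P i / 2)\<^sup>2 + (\<Lambda> \<mu> i)\<^sup>2)"
      "dist c (vertex P (Suc i)) = sqrt ((side_length P i / 2)\<^sup>2 + (\<Lambda> \<mu> i)\<^sup>2)" if "i < CARD('n)" for i
      unfolding len[symmetric] by (subst c[OF that], rule dist_bisector_point[OF ne])+
    have r: "dist c (vertex P i) = r" if "i < CARD('n)" for i
      using that
    proof (induction i)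
      case (Suc i)
      then have "dist c (vertex P (Suc i)) = dist c (vertex P i)" using d[of i] by simp
      then show ?case using Suc by simp
    qed (simp add: r_def)
    have rpos: "r > 0"
    proof -
      have "side_length P 0 > 0" using e[of 0] by (simp add: side_length_edge)
      then have "(side_length P 0 / 2)\<^sup>2 + (\<Lambda> \<mu> 0)\<^sup>2 > 0" by (simp add: sum_power2_gt_zero_iff)
      then show ?thesis unfolding r_def d(1)[OF zero_less_card_finite] by (rule real_sqrt_gt_zero)
    qed
    have sl: "(side_length P i)\<^sup>2 = 4 * (r\<^sup>2 - (\<mu> j)\<^sup>2)" if "j < length N" "i \<in> block N j" for i j
    proof -
      have i: "i < CARD('n)" using block_subset[OF that] n by simp
      have "r\<^sup>2 = (side_length P i / 2)\<^sup>2 + (\<Lambda> \<mu> i)\<^sup>2"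
        using d(1)[OF i] r[OF i] by simp
      then show ?thesis unfolding \<Lambda>_block[OF that] by (simp add: power_divide)
    qed
    have sides: "side_length P i = snd (N ! j) / real (fst (N ! j))" if j: "j < length N" "i \<in> block N j" for i j
    proof -
      have "side_length P k = side_length P i" if "k \<in> block N j" for k
      proof (rule power2_eq_imp_eq)
        show "(side_length P k)\<^sup>2 = (side_length P i)\<^sup>2"
          unfolding sl[OF j] sl[OF j(1) that] ..
      qed (simp_all add: side_length_def)
      then have "block_length N j P = real (card (block N j)) * side_length P i"
        by (simp add: block_length_def)
      moreover have "card (block N j) = fst (N ! j)"
        using total_number_take_Suc[OF j(1)] by (simp add: block_def)
      moreover have "block_length N j P = snd (N ! j)" using P j(1) by (simp add: configurations_def)
      moreover have "fst (N ! j) > 0"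
        using N nth_mem[OF j(1)] by (auto simp: is_necklace_def case_prod_unfold)
      ultimately show ?thesis by (simp add: field_simps)
    qed
    have so: "side_orientation c P i = (if \<mu> j > 0 then 1 else if \<mu> j = 0 then 0 else - 1)"
      if "j < length N" "i \<in> block N j" for i j
    proof -
      have "i < CARD('n)" using block_subset[OF that] n by simp
      from side_orientation_bisector_point[OF e c[OF this]] show ?thesis
        unfolding \<Lambda>_block[OF that] .
    qed
    have "side_orientation c P i = side_orientation c P k"
      if "j < length N" "i \<in> block N j" "k \<in> block N j" for i j k
      unfolding so[OF that(1,2)] so[OF that(1,3)] ..
    then have "\<forall>j<length N. \<forall>i\<^sub>1\<in>block N j. \<forall>i\<^sub>2\<in>block N j.
        side_orientation c P i\<^sub>1 = side_orientation c P i\<^sub>2" by (intro allI impI ballI)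
    moreover have "\<forall>i<CARD('n). dist c (vertex P i) = r" by (intro allI impI r)
    moreover have "\<forall>j<length N. \<forall>i\<in>block N j. side_length P i = snd (N ! j) / real (fst (N ! j))"
      by (intro allI impI ballI sides)
    ultimately show "inscribed_necklace N P"
      unfolding inscribed_necklace_def using rpos by (intro conjI exI[of _ c] exI[of _ r])
  next
    assume "inscribed_necklace N P"
    then obtain c r where cr: "\<forall>i<CARD('n). dist c (vertex P i) = r"
      "\<forall>j<length N. \<forall>i\<^sub>1\<in>block N j. \<forall>i\<^sub>2\<in>block N j.
         side_orientation c P i\<^sub>1 = side_orientation c P i\<^sub>2"
      "\<forall>j<length N. \<forall>i\<in>block N j. side_length P i = snd (N ! j) / real (fst (N ! j))"
      unfolding inscribed_necklace_def by (elim conjE exE) (rule that)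
    have r: "dist c (vertex P i) = r" if "i < CARD('n)" for i
      using that cr(1) by (elim allE[of _ i] impE)
    have o: "side_orientation c P i = side_orientation c P k"
      if "j < length N" "i \<in> block N j" "k \<in> block N j" for j i k
      by (rule cr(2)[rule_format, OF that])
    have l: "side_length P i = snd (N ! j) / real (fst (N ! j))" if "j < length N" "i \<in> block N j" for j i
      by (rule cr(3)[rule_format, OF that])
    have r': "dist c (vertex P i) = r" for i
      using r[of "i mod CARD('n)"] periodic_mod[of "vertex P", OF vertex_add_card, of i] by simp
    have "\<exists>s. c = bisector_point (vertex P i) (vertex P (Suc i)) s" for i
      by (rule equidistant_imp_bisector_point[OF ne, of c i]) (simp_all only: r', blast)
    then obtain s where s: "\<And>i. c = bisector_point (vertex P i) (vertex P (Suc i)) (s i)"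
      using choice[of "\<lambda>i s. c = bisector_point (vertex P i) (vertex P (Suc i)) s"] by blast
    \<comment> \<open>The multiplier of a bead is the height of the centre over its first
      side.\<close>
    define \<mu> where "\<mu> = (\<lambda>j. s (total_number (take j N)))"
    have s2: "(s i)\<^sup>2 = r\<^sup>2 - (side_length P i / 2)\<^sup>2" for i
    proof -
      have "dist c (vertex P i) = sqrt ((side_length P i / 2)\<^sup>2 + (s i)\<^sup>2)"
        unfolding len[symmetric] by (subst s[of i]) (rule dist_bisector_point[OF ne])
      then show ?thesis using r' by simp
    qed
    have s_eq: "s i = \<mu> j" if j: "j < length N" "i \<in> block N j" for i j
    proof -
      define k where "k = total_number (take j N)"
      have k: "k \<in> block N j" using j(2) by (simp add: block_def k_def)
      have "(s i)\<^sup>2 = (s k)\<^sup>2" unfolding s2 l[OF j] l[OF j(1) k] ..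
      moreover have "(if s i > 0 then 1 else if s i = 0 then 0 else - 1) =
          (if s k > 0 then 1 else if s k = 0 then 0 else - 1 :: int)"
        using o[OF j k] side_orientation_bisector_point[OF e s] by simp
      ultimately have "s i = s k" by (auto simp: power2_eq_iff split: if_splits)
      then show ?thesis by (simp add: \<mu>_def k_def)
    qed
    have "C \<mu> i = c" for i
    proof -
      have "i mod CARD('n) < total_number N" using n by (metis mod_less_divisor zero_less_card_finite)
      from s_eq[OF bead_total[OF this]]
      have *: "s (i mod CARD('n)) = \<Lambda> \<mu> i" by (simp add: \<Lambda>_def)
      have "vertex P (i mod CARD('n)) = vertex P i"
        by (rule periodic_mod[of "vertex P", OF vertex_add_card])
      moreover have "vertex P (Suc (i mod CARD('n))) = vertex P (Suc i)"
      proof (rule periodic_mod)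
        show "vertex P (Suc (i + CARD('n))) = vertex P (Suc i)" for i
          using vertex_add_card[of P "Suc i"] by simp
      qed
      ultimately show ?thesis
        using s[of "i mod CARD('n)"] * by (simp add: C_def)
    qed
    then show "\<exists>\<mu>. \<forall>i<CARD('n). C \<mu> (Suc i) = C \<mu> i" by (intro exI[of _ \<mu>]) simp
  qed
  show ?thesis unfolding iff by (rule centre)
qed

section \<open>Isometries and non-singular configurations\<close>

lemma inner_ii_cnj: "(\<i> * x) \<bullet> y = Im (cnj x * y)"
  by (simp add: inner_complex_def)

text \<open>After a translation the map fixes 0, so by polarisation it preserves inner products.
  Relative to \<open>a = h 1\<close>, the image of \<open>\<i>\<close> is a unit vector orthogonal
  to 1, and the orientation condition selects \<open>\<i>\<close> rather than its negative.\<close>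

lemma Isom_plus_affine:
  assumes "g \<in> Isom_plus"
  obtains a b where "cmod a = 1" "\<And>z. g z = a * z + b"
proof -
  define h where "h = (\<lambda>z. g z - g 0)"
  have iso: "cmod (g z - g w) = cmod (z - w)" for z w
    using assms by (simp add: Isom_plus_def dist_norm)
  have "cmod (h z - h w) = cmod (z - w)" "cmod (h z) = cmod z" for z w
    using iso[of z w] iso[of z 0] by (simp_all add: h_def)
  then have inner_h: "h z \<bullet> h w = z \<bullet> w" for z w by (simp add: dot_norm_neg)
  define a where "a = h 1"
  have "a \<bullet> a = 1" unfolding a_def inner_h by simp
  then have a1: "cmod a = 1" by (simp add: norm_eq_sqrt_inner)
  then have aa: "a * cnj a = 1" by (simp add: complex_norm_square[symmetric])
  define u where "u = cnj a * h \<i>"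
  have "Re u = 0" using inner_h[of 1 \<i>] by (simp add: u_def a_def inner_complex_def)
  moreover have "cmod u = 1"
    using inner_h[of \<i> \<i>] a1 by (simp add: u_def norm_mult norm_eq_sqrt_inner[of "h \<i>"])
  moreover have "Im u > 0" using assms by (simp add: Isom_plus_def u_def a_def h_def)
  ultimately have "u = \<i>" by (simp add: complex_eq_iff cmod_def)
  then have hi: "h \<i> = \<i> * a"
    using aa by (metis mult.assoc mult.commute mult_1 u_def)
  have "h z = a * z" for z
  proof -
    have "Re (cnj a * h z) = Re z" using inner_h[of 1 z] by (simp add: a_def inner_complex_def)
    moreover have "Im (cnj a * h z) = Im z"
      using inner_h[of \<i> z] unfolding hi inner_ii_cnj by (simp add: inner_complex_def)
    ultimately have "cnj a * h z = z" by (simp add: complex_eq_iff)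
    then have "a * z = (a * cnj a) * h z" by (simp add: mult.assoc)
    then show ?thesis by (simp add: aa)
  qed
  then have "g z = a * z + g 0" for z by (metis diff_add_cancel h_def)
  then show ?thesis using that[OF a1] by blast
qed

text \<open>Rotations preserve each summand; a translation adds a difference of consecutive terms,
  which telescopes around the closed polygon.\<close>

lemma oriented_area_Isom_plus:
  fixes P :: "'n::finite polygon"
  assumes "g \<in> Isom_plus"
  shows "oriented_area (\<chi> k. g (P $ k) :: 'n polygon) = oriented_area P"
proof -
  obtain a b where a: "cmod a = 1" and g: "\<And>z. g z = a * z + b"
    using Isom_plus_affine[OF assms] by blast
  have aa: "cnj a * a = 1" using a by (metis complex_norm_square mult.commute of_real_1 power_one)
  have v: "vertex (\<chi> k. g (P $ k) :: 'n polygon) i = g (vertex P i)" for i by (simp add: vertex_def)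
  have expand: "(\<i> * g z) \<bullet> g w = (\<i> * z) \<bullet> w + ((\<i> * b) \<bullet> (a * w) - (\<i> * b) \<bullet> (a * z))" for z w
  proof -
    have "cnj (a * z) * (a * w) = (cnj a * a) * (cnj z * w)" by simp
    then have rot: "cnj (a * z) * (a * w) = cnj z * w" by (simp only: aa mult_1)
    have "Im (cnj (x + b) * (y + b)) = Im (cnj x * y) + (Im (cnj b * y) - Im (cnj b * x))" for x y
      by (simp add: algebra_simps)
    from this[of "a * z" "a * w"] show ?thesis
      unfolding g inner_ii_cnj rot .
  qed
  have "(\<Sum>i<CARD('n). (\<i> * b) \<bullet> (a * vertex P (Suc i)) - (\<i> * b) \<bullet> (a * vertex P i)) = 0"
    using sum_lessThan_telescope[of "\<lambda>i. (\<i> * b) \<bullet> (a * vertex P i)" "CARD('n)"]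
    by (simp only: vertex_card diff_self)
  then show ?thesis
    unfolding oriented_area_inner v expand sum.distrib by simp
qed

lemma id_Isom_plus: "(\<lambda>z. z) \<in> Isom_plus"
  by (simp add: Isom_plus_def)

lemma moduli_area_orbit: "moduli_area (orbit P) = oriented_area P"
proof -
  have const: "oriented_area Q = oriented_area P" if "Q \<in> orbit P" for Q
    using that by (auto simp: orbit_def oriented_area_Isom_plus)
  have mem: "(\<chi> k. P $ k) \<in> orbit P" 
    unfolding orbit_def by (rule CollectI, rule exI[of _ "\<lambda>z. z"]) (simp add: id_Isom_plus)
  have "oriented_area ` orbit P = (\<lambda>_. oriented_area P) ` orbit P"
    by (rule image_cong[OF refl const])
  also have "\<dots> = {oriented_area P}" by (rule image_constant[OF mem])
  finally show ?thesis by (simp add: moduli_area_def)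
qed

section \<open>Sides of non-singular configurations\<close>

lemma edge_add_scaleR: "edge (P + t *\<^sub>R v) i = edge P i + t *\<^sub>R edge v i"
  by (simp add: edge_def vertex_add vertex_scaleR scaleR_diff_right)

lemma side_length_second_difference:
  "side_length (P + t *\<^sub>R v) i + side_length (P + (- t) *\<^sub>R v) i - 2 * side_length P i \<ge> 0"
proof -
  have "cmod (2 *\<^sub>R edge P i) \<le> cmod (edge P i + t *\<^sub>R edge v i) + cmod (edge P i + (- t) *\<^sub>R edge v i)"
    using norm_triangle_ineq[of "edge P i + t *\<^sub>R edge v i" "edge P i + (- t) *\<^sub>R edge v i"]
    by (simp add: scaleR_2)
  then show ?thesis unfolding side_length_edge edge_add_scaleR by simp
qed

text \<open>The length function is convex along lines, so no cancellation between the sides of a bead can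
  repair the kink of the norm at a vanishing edge.\<close>

lemma nonsingular_edge_nonzero:
  fixes P :: "'n::finite polygon"
  assumes N: "is_necklace N" "CARD('n) = total_number N"
    and P: "P \<in> nonsingular_configurations N"
  shows "edge P i \<noteq> 0"
proof
  assume "edge P i = 0"
  define m where "m = i mod CARD('n)"
  have "edge P m = 0"
    using periodic_mod[of "edge P", OF edge_add_card, of i] \<open>edge P i = 0\<close> by (simp add: m_def)
  have m: "m < total_number N" using N(2) by (simp add: m_def flip: N(2))
  define j where "j = bead N m"
  have j: "j < length N" "m \<in> block N j" using bead_total[OF m] by (simp_all add: j_def)
  have conf: "block_length N j P = snd (N ! j)"
    using P j(1) by (simp add: nonsingular_configurations_def configurations_def)
  have "snd (N ! j) > 0" using N(1) nth_mem[OF j(1)] by (auto simp: is_necklace_def case_prod_unfold)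
  then have len: "block_length N j P > 0" by (simp add: conf)
  have "CARD('n) \<noteq> 1"
  \<comment> \<open>With one vertex the only side joins it to itself, contradicting the positive
    bead length. Two or more vertices ensure that moving vertex \<open>m\<close> alone changes edge
    \<open>m\<close>.\<close>
  proof
    assume c: "CARD('n) = 1"
    have "side_length P k = 0" if "k \<in> block N j" for k
    proof -
      have "k = 0" using block_subset[OF j(1) that] N(2) c by simp
      then show ?thesis using vertex_card[of P] c by (simp add: side_length_def)
    qed
    then show False using len by (simp add: block_length_def)
  qed
  then have n2: "CARD('n) \<ge> 2"
    using zero_less_card_finite[where 'a = 'n] by linarith
  define \<alpha> where "\<alpha> = (\<lambda>k. if k mod CARD('n) = m then 1 else (0::complex))"
  have "\<alpha> (k + CARD('n)) = \<alpha> k" for k by (simp add: \<alpha>_def)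
  from polygon_with_vertices[of \<alpha>, OF this]
  obtain v :: "'n polygon" where v: "\<And>k. vertex v k = \<alpha> k" by blast
  have mn: "m < CARD('n)" by (simp add: m_def)
  have "Suc m mod CARD('n) \<noteq> m"
    using mn n2 by (cases "Suc m = CARD('n)") auto
  then have ev: "edge v m = - 1" using mn by (simp add: edge_def v \<alpha>_def)
  \<comment> \<open>In the symmetric sum the linear parts cancel, so \<open>\<psi>\<close> has
    derivative 0 at 0. Yet the vanishing edge contributes \<open>2 * t\<close> and convexity
    prevents the other sides from compensating, against the bound \<open>t\<close> for small
    \<open>t\<close>.\<close>
  define \<psi> where "\<psi> = (\<lambda>t. block_length N j (P + t *\<^sub>R v) + block_length N j (P + (- t) *\<^sub>R v))"
  obtain D where D: "(block_length N j has_derivative D) (at P)"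
    using P j(1) unfolding nonsingular_configurations_def nonsingular_def by blast
  have D1: "((\<lambda>t. block_length N j (P + t *\<^sub>R v)) has_derivative (\<lambda>t. D (0 + t *\<^sub>R v))) (at 0)"
    by (rule has_derivative_compose[of "\<lambda>t. P + t *\<^sub>R v"])
      (rule has_derivative_add has_derivative_const has_derivative_scaleR_left has_derivative_ident | simp add: D)+
  have D2: "((\<lambda>t. block_length N j (P + (- t) *\<^sub>R v)) has_derivative (\<lambda>t. D (0 + (- t) *\<^sub>R v))) (at 0)"
    by (rule has_derivative_compose[of "\<lambda>t. P + (- t) *\<^sub>R v"])
      (rule has_derivative_add has_derivative_const has_derivative_scaleR_left has_derivative_minus has_derivative_ident | simp add: D)+
  have lD: "linear D" using D has_derivative_linear by blast
  have "(\<psi> has_derivative (\<lambda>t. D (0 + t *\<^sub>R v) + D (0 + (- t) *\<^sub>R v))) (at 0)"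
    unfolding \<psi>_def by (rule has_derivative_add[OF D1 D2])
  then have "(\<psi> has_derivative (\<lambda>t. 0)) (at 0)"
    by (rule has_derivative_eq_rhs) (simp add: linear_neg[OF lD])
  then obtain d where d: "d > 0" "\<And>t. norm (t - 0) < d \<Longrightarrow> norm (\<psi> t - \<psi> 0 - 0) \<le> 1 * norm (t - 0)"
    unfolding has_derivative_at_alt using zero_less_one by blast
  have "2 * t \<le> \<psi> t - \<psi> 0" if "t > 0" for t
  proof -
    define s where "s = (\<lambda>k. side_length (P + t *\<^sub>R v) k + side_length (P + (- t) *\<^sub>R v) k - 2 * side_length P k)"
    have "\<psi> t - \<psi> 0 = (\<Sum>k\<in>block N j. s k)"
      by (simp add: \<psi>_def s_def block_length_def sum.distrib sum_subtractf sum_distrib_left)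
    also have "\<dots> \<ge> s m"
    proof (rule member_le_sum[OF j(2)])
      show "0 \<le> s k" for k unfolding s_def by (rule side_length_second_difference)
    qed (simp add: block_def)
    also have "s m = 2 * t"
    proof -
      have "s m = cmod (t *\<^sub>R edge v m) + cmod ((- t) *\<^sub>R edge v m)"
        unfolding s_def side_length_edge edge_add_scaleR \<open>edge P m = 0\<close> by simp
      then show ?thesis using that unfolding ev by simp
    qed
    finally show ?thesis by simp
  qed
  from this[of "d / 2"] d(2)[of "d / 2"] d(1) show False by auto
qed

lemma nonsingular_iff_block_derivative:
  assumes "\<And>i. edge P i \<noteq> 0"
  shows "nonsingular N P \<longleftrightarrow> (\<forall>y :: nat \<Rightarrow> real. \<exists>v. \<forall>j<length N. block_derivative N P j v = y j)"
proof
  assume "nonsingular N P"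
  then obtain D where D: "\<And>j. j < length N \<Longrightarrow> (block_length N j has_derivative D j) (at P)"
    and surj: "\<And>y :: nat \<Rightarrow> real. \<exists>v. \<forall>j<length N. D j v = y j"
    unfolding nonsingular_def by blast
  have "D j = block_derivative N P j" if "j < length N" for j
    by (rule has_derivative_unique[OF D[OF that] has_derivative_block_length[OF assms]])
  then show "\<forall>y :: nat \<Rightarrow> real. \<exists>v. \<forall>j<length N. block_derivative N P j v = y j"
    using surj by simp
next
  assume "\<forall>y :: nat \<Rightarrow> real. \<exists>v. \<forall>j<length N. block_derivative N P j v = y j"
  then show "nonsingular N P"
    unfolding nonsingular_def using has_derivative_block_length[OF assms]
    by (intro exI[of _ "block_derivative N P"]) simp
qed

lemma linear_block_derivative: "linear (block_derivative N P j)"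
  unfolding block_derivative_def
  by (intro linear_compose_sum ballI bounded_linear.linear[OF
      bounded_linear_compose[OF bounded_linear_inner_right bounded_linear_edge]])

text \<open>The unit edge directions depend continuously on the polygon where edges are nonzero, so
  the differential at \<open>Q\<close> is close to the surjective one at \<open>P\<close>. The
  injective map \<open>M\<close> below transfers surjectivity from \<open>P\<close> to
  \<open>Q\<close>.\<close>

lemma nonsingular_nearby:
  fixes P :: "'n::finite polygon"
  assumes edges: "\<And>i. edge P i \<noteq> 0" and n: "CARD('n) = total_number N"
    and dual: "\<And>i j. i < length N \<Longrightarrow> j < length N \<Longrightarrow> block_derivative N P i (w j) = (if i = j then 1 else 0)"
  obtains \<epsilon> where "\<epsilon> > 0" "\<And>Q. norm (Q - P) < \<epsilon> \<Longrightarrow> nonsingular N Q"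
proof -
  interpret regular_constraints "{..<length N}" "block_length N" "block_derivative N P" w P
    by unfold_locales (use edges dual in \<open>auto intro!: has_derivative_block_length continuous_block_length\<close>)
  define W where "W = (\<Sum>j<length N. norm (w j))"
  have W: "W \<ge> 0" by (simp add: W_def sum_nonneg)
  \<comment> \<open>If unit directions change by less than \<open>\<eta>\<close>, a bead
    differential changes by at most \<open>2 * real CARD('n) * \<eta> * norm a\<close>: at most
    \<open>CARD('n)\<close> sides, each edge bounded by \<open>2 * norm a\<close>. With
    \<open>\<eta> = 1 / K\<close>, the perturbation in \<open>M\<close> is a strict contraction, so
    \<open>M\<close> is injective.\<close>
  define K where "K = 2 * real CARD('n) * W + 1"
  have K: "K > 0" using W by (simp add: K_def add_nonneg_pos)
  define \<eta> where "\<eta> = 1 / K"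
  have \<eta>: "\<eta> > 0" "2 * real CARD('n) * W * \<eta> < 1" using K by (simp_all add: \<eta>_def K_def)
  have tend: "((\<lambda>Q. edge Q i) \<longlongrightarrow> edge P i) (nhds P)" for i
    by (rule bounded_linear.tendsto[OF bounded_linear_edge filterlim_ident])
  have "\<forall>\<^sub>F Q in nhds P. dist (sgn (edge Q i)) (sgn (edge P i)) < \<eta>" for i
    by (rule tendstoD[OF tendsto_sgn[OF tend edges] \<eta>(1)])
  moreover have "\<forall>\<^sub>F Q in nhds P. edge Q i \<noteq> 0" for i
    by (rule tendsto_imp_eventually_ne[OF tend edges])
  ultimately have "\<forall>\<^sub>F Q in nhds P. \<forall>i\<in>{..<CARD('n)}. edge Q i \<noteq> 0 \<and> dist (sgn (edge Q i)) (sgn (edge P i)) < \<eta>"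
    by (intro eventually_ball_finite ballI eventually_conj) auto
  then obtain \<epsilon> where \<epsilon>: "\<epsilon> > 0" "\<And>Q i. dist Q P < \<epsilon> \<Longrightarrow> i < CARD('n) \<Longrightarrow>
      edge Q i \<noteq> 0 \<and> dist (sgn (edge Q i)) (sgn (edge P i)) < \<eta>"
    unfolding eventually_nhds_metric by auto
  show ?thesis
  proof (rule that[OF \<epsilon>(1)])
    fix Q :: "'n polygon" assume "norm (Q - P) < \<epsilon>"
    then have Q: "edge Q i \<noteq> 0" "cmod (sgn (edge Q i) - sgn (edge P i)) < \<eta>" if "i < CARD('n)" for i
      using \<epsilon>(2)[OF _ that] by (auto simp: dist_norm)
    have Q': "edge Q i \<noteq> 0" for i
      using Q(1)[of "i mod CARD('n)"] periodic_mod[of "edge Q", OF edge_add_card, of i] by simp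
    define \<Delta> where "\<Delta> = (\<lambda>j a. block_derivative N Q j a - block_derivative N P j a)"
    have \<Delta>: "\<bar>\<Delta> j a\<bar> \<le> 2 * real CARD('n) * \<eta> * norm a" if j: "j < length N" for j a
    proof -
      have "block N j \<subseteq> {..<CARD('n)}" using block_subset[OF j] by (auto simp: n)
      then have "card (block N j) \<le> CARD('n)" using card_mono[of "{..<CARD('n)}"] by simp
      have "\<Delta> j a = (\<Sum>i\<in>block N j. (sgn (edge Q i) - sgn (edge P i)) \<bullet> edge a i)"
        by (simp add: \<Delta>_def block_derivative_def inner_diff_left sum_subtractf)
      also have "\<bar>\<dots>\<bar> \<le> (\<Sum>i\<in>block N j. \<eta> * (2 * norm a))"
      proof (intro order_trans[OF sum_abs] sum_mono)
        fix i assume "i \<in> block N j"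
        then have "i < CARD('n)" using block_subset[OF j] by (simp add: n)
        have "\<bar>(sgn (edge Q i) - sgn (edge P i)) \<bullet> edge a i\<bar> \<le> cmod (sgn (edge Q i) - sgn (edge P i)) * cmod (edge a i)"
          by (rule Cauchy_Schwarz_ineq2)
        also have "\<dots> \<le> \<eta> * (2 * norm a)"
          using Q(2)[OF \<open>i < CARD('n)\<close>] norm_edge_le[of a i] \<eta>(1) by (intro mult_mono) auto
        finally show "\<bar>(sgn (edge Q i) - sgn (edge P i)) \<bullet> edge a i\<bar> \<le> \<eta> * (2 * norm a)" .
      qed
      also have "\<dots> = real (card (block N j)) * (\<eta> * (2 * norm a))" by simp
      also have "\<dots> \<le> real CARD('n) * (\<eta> * (2 * norm a))"
        using \<open>card (block N j) \<le> CARD('n)\<close> \<eta>(1) by (intro mult_right_mono) auto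
      finally show ?thesis by (simp add: algebra_simps)
    qed
    \<comment> \<open>a small perturbation of the identity with
      \<open>block_derivative N P i (M a) = block_derivative N Q i a\<close>\<close>
    define M where "M = (\<lambda>a. a + (\<Sum>j<length N. \<Delta> j a *\<^sub>R w j))"
    have l\<Delta>: "linear (\<Delta> j)" for j
      unfolding \<Delta>_def by (intro linear_compose_sub linear_block_derivative)
    have lM: "linear M"
      unfolding M_def
      by (rule linearI)
        (simp_all add: linear_add[OF l\<Delta>] linear_cmul[OF l\<Delta>] scaleR_add_left sum.distrib scaleR_add_right scaleR_sum_right)
    have "a = 0" if "M a = 0" for a
    proof (rule ccontr)
      assume "a \<noteq> 0"
      have "a = - (\<Sum>j<length N. \<Delta> j a *\<^sub>R w j)" using that by (simp add: M_def eq_neg_iff_add_eq_0)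
      then have "norm a = norm (\<Sum>j<length N. \<Delta> j a *\<^sub>R w j)" by (metis norm_minus_cancel)
      also have "\<dots> \<le> (\<Sum>j<length N. 2 * real CARD('n) * \<eta> * norm a * norm (w j))"
        by (rule sum_norm_le) (use \<Delta> in \<open>auto intro!: mult_right_mono\<close>)
      also have "\<dots> = (2 * real CARD('n) * W * \<eta>) * norm a"
        by (simp add: W_def sum_distrib_left sum_distrib_right algebra_simps)
      also have "\<dots> < 1 * norm a"
        using \<eta>(2) \<open>a \<noteq> 0\<close> by (intro mult_strict_right_mono) auto
      finally show False by simp
    qed
    then have "inj M" using lM by (simp add: linear_injective_0)
    then have "surj M" using linear_injective_imp_surjective[OF lM] by blast
    have "\<exists>v. \<forall>j<length N. block_derivative N Q j v = y j" for y :: "nat \<Rightarrow> real"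
    proof -
      obtain a where a: "M a = (\<Sum>j<length N. y j *\<^sub>R w j)"
        using surjD[OF \<open>surj M\<close>] by metis
      have "block_derivative N Q i a = y i" if "i < length N" for i
      proof -
        have i: "i \<in> {..<length N}" using that by simp
        have "block_derivative N P i (M a) = block_derivative N P i a + \<Delta> i a"
          unfolding M_def linear_add[OF linear_D[OF i]]
          by (subst D_combination[OF i regular_constraints.dual[OF regular_constraints_axioms i]]) auto
        moreover have "block_derivative N P i (M a) = y i"
          unfolding a by (rule D_combination[OF i regular_constraints.dual[OF regular_constraints_axioms i]])
        ultimately show ?thesis by (simp add: \<Delta>_def)
      qed
      then show ?thesis by blast
    qed
    then show "nonsingular N Q" by (simp add: nonsingular_iff_block_derivative[OF Q'])
  qed
qed

theorem theorem4p1: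
  fixes N :: necklace
    and X :: "'n::finite polygon set topology"
    and E :: "'e::euclidean_space set"
    and \<A> :: "('n polygon set set \<times> ('n polygon set \<Rightarrow> 'e)) set"
    and P :: "'n polygon"
  assumes "is_necklace N"
    and "CARD('n) = total_number N"
    and "moduli_smooth_structure N X E \<A>"
    and "P \<in> nonsingular_configurations N"
  shows "critical_point \<A> moduli_area (orbit P) \<longleftrightarrow>
    (\<exists>c r. r > 0 \<and> (\<forall>i<CARD('n). dist c (vertex P i) = r) \<and>
       (\<forall>j<length N. \<forall>i\<^sub>1\<in>block N j. \<forall>i\<^sub>2\<in>block N j.
          side_orientation c P i\<^sub>1 = side_orientation c P i\<^sub>2)) \<and>
    (\<forall>j<length N. \<forall>i\<in>block N j. side_length P i = snd (N ! j) / real (fst (N ! j)))"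
proof -
  note N = assms(1) and n = assms(2) and smooth = assms(3) and P = assms(4)
  have P_conf: "P \<in> configurations N" and P_nons: "nonsingular N P"
    using P by (simp_all add: nonsingular_configurations_def)
  have edges: "edge P i \<noteq> 0" for i by (rule nonsingular_edge_nonzero[OF N n P])
  \<comment> \<open>Surjectivity applied to the standard basis vectors yields the dual family
    required by \<open>regular_constraints\<close>.\<close>
  have "\<exists>v. \<forall>j<length N. block_derivative N P j v = (if j = i then 1 else 0)" for i
    using P_nons unfolding nonsingular_iff_block_derivative[OF edges] by (rule spec)
  then obtain w where w: "\<And>i. \<forall>j<length N. block_derivative N P j (w i) = (if j = i then 1 else 0)"
    using choice[of "\<lambda>i v. \<forall>j<length N. block_derivative N P j v = (if j = i then 1 else 0)"] by blast
  have dual: "block_derivative N P i (w j) = (if i = j then 1 else 0)" if "i < length N" for i j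
    using w[of j] that by simp
  interpret regular_constraints "{..<length N}" "block_length N" "block_derivative N P" w P
    by unfold_locales (use edges dual in \<open>auto intro!: has_derivative_block_length continuous_block_length\<close>)
  obtain \<epsilon> where \<epsilon>: "\<epsilon> > 0" "\<And>Q. norm (Q - P) < \<epsilon> \<Longrightarrow> nonsingular N Q"
    using nonsingular_nearby[OF edges n, of w] dual by blast
  have near: "Q \<in> nonsingular_configurations N \<longleftrightarrow> (\<forall>j\<in>{..<length N}. block_length N j Q = block_length N j P)"
    if "norm (Q - P) < \<epsilon>" for Q
    using \<epsilon>(2)[OF that] P_conf by (auto simp: nonsingular_configurations_def configurations_def)
  have X: "topspace X = orbit ` nonsingular_configurations N"
    and quot: "quotient_map (top_of_set (nonsingular_configurations N)) X orbit"
    and atlas: "smooth_atlas X E \<A>"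
    and subm: "smooth_submersion (nonsingular_configurations N) orbit E \<A>"
    using smooth by (simp_all add: moduli_smooth_structure_def moduli_space_def)
  have "critical_point \<A> moduli_area (orbit P) \<longleftrightarrow>
      (\<exists>\<mu>. \<forall>v :: 'n polygon. (\<Sum>i<CARD('n). area_gradient P i \<bullet> vertex v (Suc i)) =
        (\<Sum>j<length N. \<mu> j * block_derivative N P j v))"
    by (rule critical_point_iff_multipliers[OF P \<epsilon>(1) near X quot atlas subm moduli_area_orbit
          has_derivative_oriented_area])
  also have "\<dots> \<longleftrightarrow> inscribed_necklace N P"
    by (rule lagrange_iff_inscribed_necklace[OF N n P_conf edges])
  finally show ?thesis unfolding inscribed_necklace_def .
qed

end
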